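(* The problem of deciding if a trigger is g-unblockable for a KB and a head-choice is undecidable.
   Context: Setting (restricted disjunctive chase). Rules are of the form $\forall \vec w,\vec x.[\beta(\vec w,\vec x)\to \bigvee_{i=1}^n \exists \vec y_i.\eta_i(\vec x_i,\vec y_i)]$ (constant- and function-free); $\mathrm{branching}(\rho)=n$; $\mathrm{sk}(\rho)$ replaces existential variables $y\in\vec y_i$ by skolem terms $f^\rho_{i,y}(\vec x)$. A trigger $\lambda=(\rho,\sigma)$ is a rule with a substitution on its body variables; loaded for a fact set $F$ if $\mathrm{body}(\rho)\sigma\subseteq F$; obsolete for $F$ if some extension $\sigma'$ of $\sigma$ has $\mathrm{head}_i(\rho)\sigma'\subseteq F$ for some $i$; $\mathrm{out}_i(\lambda)=\mathrm{head}_i(\mathrm{sk}(\rho))\sigma$. A KB is a pair $(\mathcal{R},D)$ of a rule set and a function-free fact set. A chase tree of a KB is a tree rooted at $D$ in which each non-leaf vertex applies an $\mathcal{R}$-trigger that is loaded and not obsolete (datalog triggers first), branching into children labelled with the parent label plus $\mathrm{out}_i(\lambda)$ for each disjunct $i$, leaves satisfy all rules, and application is fair. A head-choice $hc$ maps each rule $\rho$ to an index in $\{1,\dots,\mathrm{branching}(\rho)\}$, $\mathrm{out}_{hc}(\lambda)=\mathrm{out}_{hc(\rho)}(\lambda)$, and $\mathrm{branch}(T,hc)$ is the branch of chase tree $T$ that always follows the child given by $hc$. A trigger $\lambda$ is g-unblockable for a KB $K$ and $hc$ if for every chase tree $T$ of $K$ and every vertex $v$ on $\mathrm{branch}(T,hc)$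 for whose label $\lambda$ is loaded, some vertex $u$ on $\mathrm{branch}(T,hc)$ has $\mathrm{out}_{hc}(\lambda)\subseteq$ label$(u)$. *)

theory Defs
  imports Main "HOL-Library.Nat_Bijection"
begin

section \<open>Rules, terms and facts\<close>

text \<open>
  Variables, constants and predicate names are natural numbers.  A predicate symbol is a name
  together with the number of arguments it is applied to, so there are countably many predicates
  of every arity and no separate arity condition is needed.
\<close>

datatype 'a atom = Atom (pred: nat) (args: "'a list")

text \<open>
  A rule is given by its body and the list of its head disjuncts, all of them conjunctions of atoms
  over variables.  The quantifier prefix is implicit: the variables of the body are universally
  quantified; in each disjunct, the variables that do not occur in the body are existentially
  quantified.
\<close>

datatype rule = Rule (body: "nat atom list") (heads: "nat atom list list")

text \<open>\<open>Fn \<rho> i y\<close> is the skolem function symbol for the variable \<open>y\<close> in the \<open>i\<close>-th head disjunct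
  of \<open>\<rho>\<close>; distinct rules have distinct skolem symbols.\<close>

datatype trm = Var nat | Con nat | Fn rule nat nat "trm list"

type_synonym fact = "trm atom"
type_synonym subst = "nat \<rightharpoonup> trm"

definition vars :: "nat atom list \<Rightarrow> nat set" where
  "vars as = (\<Union>a\<in>set as. set (args a))"

definition branching :: "rule \<Rightarrow> nat" where
  "branching \<rho> = length (heads \<rho>)"

text \<open>Head disjuncts are counted from 1.\<close>

definition head :: "nat \<Rightarrow> rule \<Rightarrow> nat atom list" where
  "head i \<rho> = heads \<rho> ! (i - 1)"

definition is_rule :: "rule \<Rightarrow> bool" where
  "is_rule \<rho> \<longleftrightarrow> body \<rho> \<noteq> [] \<and> heads \<rho> \<noteq> [] \<and> (\<forall>\<eta>\<in>set (heads \<rho>). \<eta> \<noteq> [])"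

definition frontier :: "rule \<Rightarrow> nat set" where
  "frontier \<rho> = vars (body \<rho>) \<inter> (\<Union>\<eta>\<in>set (heads \<rho>). vars \<eta>)"

definition datalog :: "rule \<Rightarrow> bool" where
  "datalog \<rho> \<longleftrightarrow> branching \<rho> = 1 \<and> vars (head 1 \<rho>) \<subseteq> vars (body \<rho>)"

definition function_free :: "fact \<Rightarrow> bool" where
  "function_free a \<longleftrightarrow> (\<forall>t\<in>set (args a). \<exists>c. t = Con c)"

fun subst_trm :: "subst \<Rightarrow> trm \<Rightarrow> trm" where
  "subst_trm \<sigma> (Var x) = (case \<sigma> x of None \<Rightarrow> Var x | Some t \<Rightarrow> t)"
| "subst_trm \<sigma> (Con c) = Con c"
| "subst_trm \<sigma> (Fn \<rho> i y ts) = Fn \<rho> i y (map (subst_trm \<sigma>) ts)"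

definition subst_atoms :: "subst \<Rightarrow> trm atom list \<Rightarrow> trm atom set" where
  "subst_atoms \<sigma> as = set (map (map_atom (subst_trm \<sigma>)) as)"

text \<open>The skolem terms of all disjuncts have the whole frontier of the rule as arguments, listed in
  increasing order of the variables.\<close>

definition sk_var :: "rule \<Rightarrow> nat \<Rightarrow> nat \<Rightarrow> trm" where
  "sk_var \<rho> i z = (if z \<in> vars (body \<rho>) then Var z
     else Fn \<rho> i z (map Var (sorted_list_of_set (frontier \<rho>))))"

definition sk_head :: "nat \<Rightarrow> rule \<Rightarrow> trm atom list" where
  "sk_head i \<rho> = map (map_atom (sk_var \<rho> i)) (head i \<rho>)"


section \<open>Triggers\<close>

type_synonym trigger = "rule \<times> subst"

definition is_trigger :: "trigger \<Rightarrow> bool" where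
  "is_trigger t \<longleftrightarrow> is_rule (fst t) \<and> dom (snd t) = vars (body (fst t))"

definition triggers :: "rule set \<Rightarrow> trigger set" where
  "triggers R = {t. is_trigger t \<and> fst t \<in> R}"

definition loaded :: "trigger \<Rightarrow> fact set \<Rightarrow> bool" where
  "loaded t F \<longleftrightarrow> subst_atoms (snd t) (map (map_atom Var) (body (fst t))) \<subseteq> F"

definition obsolete :: "trigger \<Rightarrow> fact set \<Rightarrow> bool" where
  "obsolete t F \<longleftrightarrow> (\<exists>i\<in>{1..branching (fst t)}. \<exists>\<sigma>'. snd t \<subseteq>\<^sub>m \<sigma>' \<and>
     subst_atoms \<sigma>' (map (map_atom Var) (head i (fst t))) \<subseteq> F)"

definition out :: "nat \<Rightarrow> trigger \<Rightarrow> fact set" where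
  "out i t = subst_atoms (snd t) (sk_head i (fst t))"

definition satisfied :: "rule \<Rightarrow> fact set \<Rightarrow> bool" where
  "satisfied \<rho> F \<longleftrightarrow> (\<forall>t\<in>triggers {\<rho>}. loaded t F \<longrightarrow> obsolete t F)"


section \<open>Chase trees\<close>

type_synonym kb = "rule set \<times> fact set"

definition is_kb :: "kb \<Rightarrow> bool" where
  "is_kb K \<longleftrightarrow> finite (fst K) \<and> (\<forall>\<rho>\<in>fst K. is_rule \<rho>) \<and>
     finite (snd K) \<and> (\<forall>a\<in>snd K. function_free a)"

text \<open>
  A vertex is identified with the sequence of disjunct indices leading to it from the root \<open>[]\<close>.
  \<open>trg T v\<close> is the trigger applied at the vertex \<open>v\<close>, and \<open>None\<close> at the leaves.
\<close>

type_synonym vertex = "nat list"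

record chase_tree =
  vertices :: "vertex set"
  label :: "vertex \<Rightarrow> fact set"
  trg :: "vertex \<Rightarrow> trigger option"

text \<open>The maximal paths from the root.\<close>

definition branches :: "chase_tree \<Rightarrow> vertex set set" where
  "branches T = {B. B \<subseteq> vertices T \<and> [] \<in> B \<and>
     (\<forall>v i. v @ [i] \<in> B \<longrightarrow> v \<in> B) \<and>
     (\<forall>v\<in>B. trg T v \<noteq> None \<longrightarrow> (\<exists>!i. v @ [i] \<in> B))}"

definition is_chase_tree :: "kb \<Rightarrow> chase_tree \<Rightarrow> bool" where
  "is_chase_tree K T \<longleftrightarrow>
     [] \<in> vertices T \<and> label T [] = snd K \<and>
     (\<forall>v i. v @ [i] \<in> vertices T \<longrightarrow> v \<in> vertices T) \<and>
     (\<forall>v\<in>vertices T. case trg T v of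
        None \<Rightarrow> (\<forall>i. v @ [i] \<notin> vertices T) \<and> (\<forall>\<rho>\<in>fst K. satisfied \<rho> (label T v))
      | Some t \<Rightarrow>
          t \<in> triggers (fst K) \<and> loaded t (label T v) \<and> \<not> obsolete t (label T v) \<and>
          ((\<exists>t'\<in>triggers (fst K). datalog (fst t') \<and> loaded t' (label T v) \<and>
              \<not> obsolete t' (label T v)) \<longrightarrow> datalog (fst t)) \<and>
          (\<forall>i. v @ [i] \<in> vertices T \<longleftrightarrow> i \<in> {1..branching (fst t)}) \<and>
          (\<forall>i\<in>{1..branching (fst t)}. label T (v @ [i]) = label T v \<union> out i t)) \<and>
     (\<forall>B\<in>branches T. \<forall>v\<in>B. \<forall>t\<in>triggers (fst K).
        loaded t (label T v) \<longrightarrow> (\<exists>u\<in>B. obsolete t (label T u)))"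


section \<open>Head-choices and g-unblockability\<close>

type_synonym head_choice = "rule \<Rightarrow> nat"

definition is_head_choice :: "head_choice \<Rightarrow> bool" where
  "is_head_choice hc \<longleftrightarrow> (\<forall>\<rho>. is_rule \<rho> \<longrightarrow> hc \<rho> \<in> {1..branching \<rho>})"

definition out_hc :: "head_choice \<Rightarrow> trigger \<Rightarrow> fact set" where
  "out_hc hc t = out (hc (fst t)) t"

inductive_set branch :: "chase_tree \<Rightarrow> head_choice \<Rightarrow> vertex set"
  for T :: chase_tree and hc :: head_choice where
  root: "[] \<in> branch T hc"
| step: "v \<in> branch T hc \<Longrightarrow> trg T v = Some t \<Longrightarrow> v @ [hc (fst t)] \<in> branch T hc"

definition g_unblockable :: "trigger \<Rightarrow> kb \<Rightarrow> head_choice \<Rightarrow> bool" where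
  "g_unblockable t K hc \<longleftrightarrow>
     (\<forall>T. is_chase_tree K T \<longrightarrow>
       (\<forall>v\<in>branch T hc. loaded t (label T v) \<longrightarrow>
         (\<exists>u\<in>branch T hc. out_hc hc t \<subseteq> label T u)))"


section \<open>Finite presentation of problem instances\<close>

text \<open>
  Finite sets are presented by lists and substitutions by association lists.  A head-choice is
  presented by an association list, where the rules not listed are mapped to 1.  This covers all
  behaviours: for a trigger \<open>(\<rho>, \<sigma>)\<close> and a KB \<open>(R, D)\<close>, g-unblockability depends on the
  head-choice only through its values on the finite set \<open>R \<union> {\<rho>}\<close>.
\<close>

definition hc_of :: "(rule \<times> nat) list \<Rightarrow> head_choice" where
  "hc_of hcs \<rho> = (case map_of hcs \<rho> of None \<Rightarrow> 1 | Some i \<Rightarrow> i)"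

definition enc_atom :: "('a \<Rightarrow> nat) \<Rightarrow> 'a atom \<Rightarrow> nat" where
  "enc_atom f a = prod_encode (pred a, list_encode (map f (args a)))"

definition enc_rule :: "rule \<Rightarrow> nat" where
  "enc_rule \<rho> = prod_encode
     (list_encode (map (enc_atom id) (body \<rho>)),
      list_encode (map (\<lambda>\<eta>. list_encode (map (enc_atom id) \<eta>)) (heads \<rho>)))"

fun enc_trm :: "trm \<Rightarrow> nat" where
  "enc_trm (Var x) = prod_encode (0, x)"
| "enc_trm (Con c) = prod_encode (1, c)"
| "enc_trm (Fn \<rho> i y ts) = prod_encode (2, prod_encode (enc_rule \<rho>,
     prod_encode (i, prod_encode (y, list_encode (map enc_trm ts)))))"

type_synonym instance_data =
  "rule list \<times> fact list \<times> (rule \<times> nat) list \<times> rule \<times> (nat \<times> trm) list"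

fun enc_instance :: "instance_data \<Rightarrow> nat" where
  "enc_instance (rs, fs, hcs, \<rho>, s) =
     prod_encode (list_encode (map enc_rule rs),
     prod_encode (list_encode (map (enc_atom enc_trm) fs),
     prod_encode (list_encode (map (\<lambda>(r, i). prod_encode (enc_rule r, i)) hcs),
     prod_encode (enc_rule \<rho>,
       list_encode (map (\<lambda>(x, t). prod_encode (x, enc_trm t)) s)))))"

lemma list_encode_inject: "list_encode xs = list_encode ys \<longleftrightarrow> xs = ys"
  by (rule inj_eq) (rule inj_list_encode)

lemma inj_enc_atom: "inj f \<Longrightarrow> inj (enc_atom f)"
  by (rule injI) (auto simp: enc_atom_def list_encode_inject inj_map_eq_map intro: atom.expand)

lemma inj_enc_rule: "inj enc_rule"
proof (rule injI)
  fix r s assume "enc_rule r = enc_rule s"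
  moreover have a: "inj (enc_atom (id :: nat \<Rightarrow> nat))"
    by (rule inj_enc_atom) simp
  moreover have "inj (\<lambda>\<eta>. list_encode (map (enc_atom (id :: nat \<Rightarrow> nat)) \<eta>))"
    by (rule injI) (simp add: list_encode_inject inj_map_eq_map[OF a])
  ultimately show "r = s"
    by (simp add: enc_rule_def list_encode_inject inj_map_eq_map rule.expand)
qed

lemma enc_trm_eqD: "enc_trm t = enc_trm u \<Longrightarrow> t = u"
proof (induction t arbitrary: u)
  case (Fn r i y ts)
  from Fn.prems obtain us where u: "u = Fn r i y us" and m: "map enc_trm ts = map enc_trm us"
    by (cases u) (auto simp: inj_eq[OF inj_enc_rule] list_encode_inject)
  from m Fn.IH have "ts = us"
    by (rule list.inj_map_strong[rotated])
  with u show ?case by simp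
next
  case (Var x)
  then show ?case by (cases u) auto
next
  case (Con c)
  then show ?case by (cases u) auto
qed

lemma inj_enc_trm: "inj enc_trm"
  by (rule injI) (rule enc_trm_eqD)

lemma inj_enc_instance: "inj enc_instance"
proof (rule injI)
  fix I J :: instance_data
  assume eq: "enc_instance I = enc_instance J"
  have 1: "inj (\<lambda>(r, i). prod_encode (enc_rule r, i))"
    by (auto simp: inj_def inj_eq[OF inj_enc_rule])
  have 2: "inj (\<lambda>(x, t). prod_encode (x, enc_trm t))"
    by (auto simp: inj_def inj_eq[OF inj_enc_trm])
  show "I = J"
    using eq by (cases I; cases J)
      (simp add: list_encode_inject inj_map_eq_map[OF inj_enc_rule] inj_map_eq_map[OF 1] inj_map_eq_map[OF 2]
        inj_map_eq_map[OF inj_enc_atom[OF inj_enc_trm]] inj_eq[OF inj_enc_rule])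
qed


section \<open>Decidability\<close>

text \<open>
  Partial recursive functions.  \<open>reval f xs = None\<close> means that \<open>f\<close> is undefined on \<open>xs\<close>.
\<close>

datatype recf =
    Zero
  | Succ
  | Proj nat
  | Comp recf "recf list"
  | PrimRec recf recf
  | Mu recf

fun reval :: "recf \<Rightarrow> nat list \<Rightarrow> nat option" where
  "reval Zero xs = Some 0"
| "reval Succ xs = (case xs of [x] \<Rightarrow> Some (Suc x) | _ \<Rightarrow> None)"
| "reval (Proj i) xs = (if i < length xs then Some (xs ! i) else None)"
| "reval (Comp f gs) xs =
     (let ys = map (\<lambda>g. reval g xs) gs
      in if None \<in> set ys then None else reval f (map the ys))"
| "reval (PrimRec f g) xs = (case xs of
       [] \<Rightarrow> None
     | n # zs \<Rightarrow> rec_nat (reval f zs)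
         (\<lambda>m r. case r of None \<Rightarrow> None | Some y \<Rightarrow> reval g (m # y # zs)) n)"
| "reval (Mu f) xs =
     (if \<exists>n. reval f (n # xs) = Some 0 \<and> (\<forall>m<n. reval f (m # xs) \<noteq> None)
      then Some (LEAST n. reval f (n # xs) = Some 0) else None)"

definition decidable :: "nat set \<Rightarrow> bool" where
  "decidable A \<longleftrightarrow> (\<exists>f. \<forall>n. reval f [n] = Some (if n \<in> A then 1 else 0))"

end

theory Submission
  imports Defs "HOL-Library.Countable"
begin

text \<open>
  The proof is a diagonal argument in which programs are rule sets.  For every recursive function
  \<open>h\<close> there is a finite rule set that evaluates \<open>h\<close> by the chase: its atoms record the calls of the
  subfunctions of \<open>h\<close> and their values, and a single existential rule creates the successors of
  numbers on demand.  If \<open>h\<close> is defined on \<open>m\<close>, then only finitely many calls occur, so the chase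
  from a database with the unary representation of \<open>m\<close> terminates, and it derives a goal fact iff
  \<open>h\<close> has value 0.  The goal fact is the output of the trigger of a query rule outside of the rule
  set; that trigger is loaded from the start, so it is g-unblockable iff \<open>h\<close> has value 0 on \<open>m\<close>.

  Given a decision procedure \<open>d\<close>, let \<open>h\<close> map \<open>m\<close> to the answer of \<open>d\<close> on the instance that consists
  of the rule set with the code \<open>m\<close> and the input \<open>m\<close>.  On the code of the rule set of \<open>h\<close>,
  g-unblockability then holds iff \<open>d\<close> denies it.
\<close>

section \<open>Predicate symbols\<close>

instance recf :: countable
  by countable_datatype

text \<open>Indexing by the function keeps the calls, values and searches of different subfunctions
  apart; countability turns the symbols into predicate names.\<close>

datatype symbol = ZeroS | SuccS | StartS | GoalS | CallS recf | RetS recf | SearchS recf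

instance symbol :: countable
  by countable_datatype

definition satom :: "symbol \<Rightarrow> 'a list \<Rightarrow> 'a atom" where
  "satom s ts = Atom (to_nat s) ts"

lemma satom_eq_iff [simp]: "satom s ts = satom s' ts' \<longleftrightarrow> s = s' \<and> ts = ts'"
  by (simp add: satom_def)

lemma map_atom_satom [simp]: "map_atom f (satom s ts) = satom s (map f ts)"
  by (simp add: satom_def)

lemma args_satom [simp]: "args (satom s ts) = ts"
  by (simp add: satom_def)

lemma set_atom_args: "set_atom a = set (args a)"
  by (cases a) simp

lemma is_rule_Rule [simp]:
  "is_rule (Rule bs hs) \<longleftrightarrow> bs \<noteq> [] \<and> hs \<noteq> [] \<and> (\<forall>\<eta>\<in>set hs. \<eta> \<noteq> [])"
  by (simp add: is_rule_def)

lemma datalog_Rule [simp]: "datalog (Rule bs [\<eta>]) \<longleftrightarrow> vars \<eta> \<subseteq> vars bs"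
  by (simp add: datalog_def branching_def head_def)

lemma head_Rule [simp]: "head (Suc 0) (Rule bs [\<eta>]) = \<eta>"
  by (simp add: head_def)


section \<open>Triggers and chase trees\<close>

lemma subst_atoms_Var:
  "subst_atoms \<sigma> (map (map_atom Var) as) = map_atom (\<lambda>x. subst_trm \<sigma> (Var x)) ` set as"
  by (simp add: subst_atoms_def atom.map_comp image_image comp_def del: subst_trm.simps)

lemma map_atom_image_cong:
  assumes "\<And>x. x \<in> vars as \<Longrightarrow> f x = g x"
  shows "map_atom f ` set as = map_atom g ` set as"
  using assms by (intro image_cong refl atom.map_cong) (auto simp: vars_def set_atom_args)

lemma subst_trm_Var_dom: "x \<in> dom \<sigma> \<Longrightarrow> subst_trm \<sigma> (Var x) = the (\<sigma> x)"
  by auto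

lemma loaded_iff:
  assumes "dom \<sigma> = vars (body \<rho>)"
  shows "loaded (\<rho>, \<sigma>) F \<longleftrightarrow> map_atom (\<lambda>x. the (\<sigma> x)) ` set (body \<rho>) \<subseteq> F"
proof -
  have "map_atom (\<lambda>x. subst_trm \<sigma> (Var x)) ` set (body \<rho>) = map_atom (\<lambda>x. the (\<sigma> x)) ` set (body \<rho>)"
    by (rule map_atom_image_cong) (use assms subst_trm_Var_dom in blast)
  then show ?thesis
    by (simp add: loaded_def subst_atoms_Var del: subst_trm.simps)
qed

lemma loaded_mono: "loaded t F \<Longrightarrow> F \<subseteq> G \<Longrightarrow> loaded t G"
  by (auto simp: loaded_def)

lemma out_eq: "out i (\<rho>, \<sigma>) = map_atom (\<lambda>z. subst_trm \<sigma> (sk_var \<rho> i z)) ` set (head i \<rho>)"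
  by (simp add: out_def sk_head_def subst_atoms_def atom.map_comp image_image comp_def)

text \<open>The output is its own witness: the extension sends each existential variable to its
  skolem term.\<close>

lemma obsolete_if_out_subset:
  assumes "is_trigger t" "i \<in> {1..branching (fst t)}" "out i t \<subseteq> F"
  shows "obsolete t F"
proof -
  obtain \<rho> \<sigma> where t: "t = (\<rho>, \<sigma>)" by fastforce
  let ?s = "\<lambda>z. Some (subst_trm \<sigma> (sk_var \<rho> i z))"
  have "\<sigma> \<subseteq>\<^sub>m ?s"
    using assms(1) by (auto simp: t map_le_def is_trigger_def sk_var_def simp flip: domIff split: option.splits)
  moreover have "subst_atoms ?s (map (map_atom Var) (head i \<rho>)) \<subseteq> F"
    using assms(3) by (simp add: t out_eq subst_atoms_Var)
  ultimately show ?thesis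
    using assms(2) unfolding obsolete_def t fst_conv snd_conv by blast
qed

lemma out_datalog:
  assumes "datalog \<rho>" "dom \<sigma> = vars (body \<rho>)"
  shows "out 1 (\<rho>, \<sigma>) = map_atom (\<lambda>x. the (\<sigma> x)) ` set (head 1 \<rho>)"
  unfolding out_eq
  by (rule map_atom_image_cong)
    (use assms subst_trm_Var_dom in \<open>auto simp: datalog_def sk_var_def simp del: subst_trm.simps\<close>)

text \<open>A datalog head has no existential variables, so an extension of \<open>\<sigma>\<close>
  has no freedom on it.\<close>

lemma obsolete_datalogD:
  assumes "datalog \<rho>" "dom \<sigma> = vars (body \<rho>)" "obsolete (\<rho>, \<sigma>) F"
  shows "map_atom (\<lambda>x. the (\<sigma> x)) ` set (head 1 \<rho>) \<subseteq> F"
proof -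
  obtain i \<sigma>' where i: "i \<in> {1..branching \<rho>}" and le: "\<sigma> \<subseteq>\<^sub>m \<sigma>'"
    and sub: "subst_atoms \<sigma>' (map (map_atom Var) (head i \<rho>)) \<subseteq> F"
    using assms(3) by (auto simp: obsolete_def)
  have "i = 1" using i assms(1) by (simp add: datalog_def)
  moreover have "map_atom (\<lambda>x. subst_trm \<sigma>' (Var x)) ` set (head 1 \<rho>)
      = map_atom (\<lambda>x. the (\<sigma> x)) ` set (head 1 \<rho>)"
  proof (rule map_atom_image_cong)
    fix x assume "x \<in> vars (head 1 \<rho>)"
    then have "x \<in> dom \<sigma>" using assms by (auto simp: datalog_def)
    moreover from this have "\<sigma>' x = \<sigma> x" using le by (simp add: map_le_def)
    ultimately show "subst_trm \<sigma>' (Var x) = the (\<sigma> x)" by auto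
  qed
  ultimately show ?thesis
    using sub by (simp add: subst_atoms_Var del: subst_trm.simps)
qed

lemma chase_treeD:
  assumes "is_chase_tree K T"
  shows "[] \<in> vertices T" "label T [] = snd K" "v @ [i] \<in> vertices T \<Longrightarrow> v \<in> vertices T"
    "v \<in> vertices T \<Longrightarrow> trg T v = None \<Longrightarrow> v @ [i] \<notin> vertices T"
    "v \<in> vertices T \<Longrightarrow> trg T v = Some t \<Longrightarrow> t \<in> triggers (fst K) \<and> loaded t (label T v)
       \<and> \<not> obsolete t (label T v)"
    "v \<in> vertices T \<Longrightarrow> trg T v = Some t \<Longrightarrow> v @ [i] \<in> vertices T \<longleftrightarrow> i \<in> {1..branching (fst t)}"
    "v \<in> vertices T \<Longrightarrow> trg T v = Some t \<Longrightarrow> i \<in> {1..branching (fst t)} \<Longrightarrow>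
       label T (v @ [i]) = label T v \<union> out i t"
    "B \<in> branches T \<Longrightarrow> v \<in> B \<Longrightarrow> t \<in> triggers (fst K) \<Longrightarrow> loaded t (label T v) \<Longrightarrow>
       \<exists>u\<in>B. obsolete t (label T u)"
proof -
  note T = assms[unfolded is_chase_tree_def]
  show "[] \<in> vertices T" "label T [] = snd K" "v @ [i] \<in> vertices T \<Longrightarrow> v \<in> vertices T"
    "B \<in> branches T \<Longrightarrow> v \<in> B \<Longrightarrow> t \<in> triggers (fst K) \<Longrightarrow> loaded t (label T v) \<Longrightarrow>
       \<exists>u\<in>B. obsolete t (label T u)"
    using T by blast+
  assume v: "v \<in> vertices T"
  have *: "case trg T v of
        None \<Rightarrow> (\<forall>i. v @ [i] \<notin> vertices T)
      | Some t \<Rightarrow> t \<in> triggers (fst K) \<and> loaded t (label T v) \<and> \<not> obsolete t (label T v) \<and>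
          (\<forall>i. v @ [i] \<in> vertices T \<longleftrightarrow> i \<in> {1..branching (fst t)}) \<and>
          (\<forall>i\<in>{1..branching (fst t)}. label T (v @ [i]) = label T v \<union> out i t)"
    using bspec[OF conjunct1[OF conjunct2[OF conjunct2[OF conjunct2[OF T]]]] v]
    by (cases "trg T v") simp_all
  show "v @ [i] \<notin> vertices T" if "trg T v = None"
    using * that by simp
  assume "trg T v = Some t"
  with * show "t \<in> triggers (fst K) \<and> loaded t (label T v) \<and> \<not> obsolete t (label T v)"
    "v @ [i] \<in> vertices T \<longleftrightarrow> i \<in> {1..branching (fst t)}"
    "i \<in> {1..branching (fst t)} \<Longrightarrow> label T (v @ [i]) = label T v \<union> out i t"
    by simp_all
qed

section \<open>The branch of a head-choice and the facts on it\<close>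

lemma branch_append_iff:
  "v @ [i] \<in> branch T hc \<longleftrightarrow> v \<in> branch T hc \<and> (\<exists>t. trg T v = Some t \<and> i = hc (fst t))"
  using branch.step[of v T hc] by (auto elim: branch.cases)

lemma triggersD:
  assumes "t \<in> triggers R"
  shows "is_trigger t" "fst t \<in> R" "is_rule (fst t)" "dom (snd t) = vars (body (fst t))"
  using assms by (auto simp: triggers_def is_trigger_def)

lemma branching_pos: "is_rule \<rho> \<Longrightarrow> 1 \<le> branching \<rho>"
  by (cases "heads \<rho>") (auto simp: is_rule_def branching_def)

lemma branch_subset_vertices:
  assumes T: "is_chase_tree K T" and hc: "is_head_choice hc"
  shows "branch T hc \<subseteq> vertices T"
proof
  fix v assume "v \<in> branch T hc"
  then show "v \<in> vertices T"
  proof induction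
    case root show ?case using chase_treeD(1)[OF T] .
  next
    case (step v t)
    then show ?case
      using chase_treeD(5,6)[OF T step.IH step.hyps(2)] hc triggersD(3)[of t]
      unfolding is_head_choice_def by blast
  qed
qed

lemma branch_in_branches:
  assumes "is_chase_tree K T" "is_head_choice hc"
  shows "branch T hc \<in> branches T"
  using branch_subset_vertices[OF assms]
  by (auto simp: branches_def branch_append_iff branch.root)

text \<open>Lengths order the vertices because a branch follows one child at each step, hence has at
  most one vertex of each length.\<close>

lemma branch_label_mono:
  assumes T: "is_chase_tree K T" and hc: "is_head_choice hc"
    and "v \<in> branch T hc" "u \<in> branch T hc" "length v \<le> length u"
  shows "label T v \<subseteq> label T u"
  using assms(3-5)
proof (induction u arbitrary: v rule: rev_induct)
  case Nil
  then show ?case by simp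
next
  have eq: "v = u" if "v \<in> branch T hc" "u \<in> branch T hc" "length v = length u" for v u
    using that
  proof (induction v arbitrary: u rule: rev_induct)
    case (snoc i v)
    then obtain j w where u: "u = w @ [j]" by (cases u rule: rev_exhaust) auto
    with snoc have "v = w" by (simp add: branch_append_iff)
    with snoc.prems u show ?case by (auto simp: branch_append_iff)
  qed simp
  case (snoc i u)
  show ?case
  proof (cases "length v = length (u @ [i])")
    case True
    then show ?thesis using eq[OF snoc.prems(1,2)] by simp
  next
    case False
    from snoc.prems obtain t where u: "u \<in> branch T hc" and t: "trg T u = Some t" "i = hc (fst t)"
      by (auto simp: branch_append_iff)
    have v: "label T v \<subseteq> label T u"
      using snoc False u by simp
    have uv: "u \<in> vertices T" "u @ [i] \<in> vertices T"
      using branch_subset_vertices[OF T hc] u snoc.prems(2) by auto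
    then have "label T (u @ [i]) = label T u \<union> out i t"
      using chase_treeD(6,7)[OF T uv(1) t(1)] by blast
    with v show ?thesis by blast
  qed
qed

definition result :: "chase_tree \<Rightarrow> head_choice \<Rightarrow> fact set" where
  "result T hc = (\<Union>v\<in>branch T hc. label T v)"

text \<open>Fairness speaks about the label of a single vertex, whereas rule bodies will be found in
  the union. The labels along a branch form a chain, which bridges the gap.\<close>

lemma finite_subset_result:
  assumes T: "is_chase_tree K T" and hc: "is_head_choice hc" and "finite A" "A \<subseteq> result T hc"
  shows "\<exists>v\<in>branch T hc. A \<subseteq> label T v"
  using assms(3,4)
proof (induction A)
  case empty
  then show ?case using branch.root by blast
next
  case (insert a A)
  then obtain v u where "v \<in> branch T hc" "A \<subseteq> label T v" "u \<in> branch T hc" "a \<in> label T u"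
    by (auto simp: result_def)
  moreover have "label T v \<subseteq> label T u \<or> label T u \<subseteq> label T v"
    using branch_label_mono[OF T hc] calculation by (meson linear)
  ultimately show ?case by blast
qed

text \<open>Fairness in terms of \<open>result\<close>. The assignment \<open>v\<close> is cut down
  to the body variables because these are the exact domain of a trigger's substitution.\<close>

lemma result_obsolete:
  assumes T: "is_chase_tree K T" and hc: "is_head_choice hc"
    and \<rho>: "\<rho> \<in> fst K" "is_rule \<rho>" and sub: "map_atom v ` set (body \<rho>) \<subseteq> result T hc"
    and \<sigma>: "\<sigma> = (\<lambda>x. if x \<in> vars (body \<rho>) then Some (v x) else None)"
  shows "dom \<sigma> = vars (body \<rho>)" "\<exists>u\<in>branch T hc. obsolete (\<rho>, \<sigma>) (label T u)"
proof -
  show dom: "dom \<sigma> = vars (body \<rho>)"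
    using \<sigma> by (auto split: if_splits)
  have "map_atom v ` set (body \<rho>) = map_atom (\<lambda>x. the (\<sigma> x)) ` set (body \<rho>)"
    by (rule map_atom_image_cong) (simp add: \<sigma>)
  moreover obtain w where w: "w \<in> branch T hc" "map_atom v ` set (body \<rho>) \<subseteq> label T w"
    using finite_subset_result[OF T hc _ sub] by auto
  ultimately have "loaded (\<rho>, \<sigma>) (label T w)"
    by (simp add: loaded_iff[OF dom])
  moreover have "(\<rho>, \<sigma>) \<in> triggers (fst K)"
    using \<rho> dom by (simp add: triggers_def is_trigger_def)
  ultimately show "\<exists>u\<in>branch T hc. obsolete (\<rho>, \<sigma>) (label T u)"
    using chase_treeD(8)[OF T branch_in_branches[OF T hc] w(1)] by blast
qed

lemma result_closed_datalog:
  assumes T: "is_chase_tree K T" and hc: "is_head_choice hc"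
    and \<rho>: "\<rho> \<in> fst K" "is_rule \<rho>" "datalog \<rho>" and sub: "map_atom v ` set (body \<rho>) \<subseteq> result T hc"
  shows "map_atom v ` set (head 1 \<rho>) \<subseteq> result T hc"
proof -
  define \<sigma> where "\<sigma> = (\<lambda>x. if x \<in> vars (body \<rho>) then Some (v x) else None)"
  note * = result_obsolete[OF T hc \<rho>(1,2) sub \<sigma>_def]
  have "map_atom v ` set (head 1 \<rho>) = map_atom (\<lambda>x. the (\<sigma> x)) ` set (head 1 \<rho>)"
    using \<rho>(3) by (intro map_atom_image_cong) (auto simp: \<sigma>_def datalog_def)
  with * obsolete_datalogD[OF \<rho>(3) *(1)] show ?thesis
    by (auto simp: result_def) blast
qed

text \<open>A set \<open>M\<close> that no chase step leaves bounds the chase.  If \<open>M\<close> is finite and no rule is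
  disjunctive, any priority-respecting sequence of steps ends, and fairness holds at its leaf.\<close>

definition bounds_chase :: "fact set \<Rightarrow> kb \<Rightarrow> bool" where
  "bounds_chase M K \<longleftrightarrow> snd K \<subseteq> M \<and>
     (\<forall>t\<in>triggers (fst K). \<forall>F. snd K \<subseteq> F \<longrightarrow> F \<subseteq> M \<longrightarrow> loaded t F \<longrightarrow> \<not> obsolete t F \<longrightarrow>
        (\<forall>i\<in>{1..branching (fst t)}. out i t \<subseteq> M))"

lemma label_subset_bound:
  assumes T: "is_chase_tree K T" and M: "bounds_chase M K" and "v \<in> vertices T"
  shows "snd K \<subseteq> label T v \<and> label T v \<subseteq> M"
  using assms(3)
proof (induction v rule: rev_induct)
  case Nil
  then show ?case using chase_treeD(2)[OF T] M by (simp add: bounds_chase_def)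
next
  case (snoc i v)
  have v: "v \<in> vertices T" using chase_treeD(3)[OF T snoc.prems] .
  then obtain t where t: "trg T v = Some t"
    using chase_treeD(4)[OF T v, of i] snoc.prems by fastforce
  note * = chase_treeD(5)[OF T v t] chase_treeD(6,7)[OF T v t, of i]
  have i: "i \<in> {1..branching (fst t)}" using *(2) snoc.prems by blast
  have "out i t \<subseteq> M"
    using M *(1) i snoc.IH[OF v] unfolding bounds_chase_def by blast
  then show ?case using *(3)[OF i] snoc.IH[OF v] by auto
qed

section \<open>A chase tree without branching\<close>

context
  fixes K :: kb
begin

private definition active :: "fact set \<Rightarrow> trigger \<Rightarrow> bool" where
  "active F t \<longleftrightarrow> t \<in> triggers (fst K) \<and> loaded t F \<and> \<not> obsolete t F"

private definition next_trigger :: "fact set \<Rightarrow> trigger option" where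
  "next_trigger F =
     (if \<exists>t. active F t \<and> datalog (fst t) then Some (SOME t. active F t \<and> datalog (fst t))
      else if \<exists>t. active F t then Some (SOME t. active F t) else None)"

private lemma next_trigger_None: "next_trigger F = None \<longleftrightarrow> (\<forall>t. \<not> active F t)"
  by (auto simp: next_trigger_def)

private lemma next_trigger_Some:
  assumes "next_trigger F = Some t"
  shows "active F t" "active F t' \<Longrightarrow> datalog (fst t') \<Longrightarrow> datalog (fst t)"
proof -
  show "active F t"
    using assms unfolding next_trigger_def
    by (metis (mono_tags, lifting) option.distinct(1) option.inject someI_ex)
  show "datalog (fst t)" if "active F t'" "datalog (fst t')"
    using assms that unfolding next_trigger_def
    by (metis (mono_tags, lifting) option.inject someI_ex)
qed

text \<open>The sequence stands still once no trigger is active, which makes it total.\<close>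

private primrec stage :: "nat \<Rightarrow> fact set" where
  "stage 0 = snd K"
| "stage (Suc n) = (case next_trigger (stage n) of None \<Rightarrow> stage n | Some t \<Rightarrow> stage n \<union> out 1 t)"

private lemma stage_mono: "n \<le> n' \<Longrightarrow> stage n \<subseteq> stage n'"
  by (rule lift_Suc_mono_le) (auto split: option.splits)

text \<open>A single path along the index 1, cut off at the first stage without an active trigger,
  if there is one.\<close>

private definition sequence_tree :: chase_tree where
  "sequence_tree = \<lparr>vertices = {replicate n 1 | n. \<forall>i<n. next_trigger (stage i) \<noteq> None},
     label = (\<lambda>v. stage (length v)), trg = (\<lambda>v. next_trigger (stage (length v)))\<rparr>"

lemma ex_chase_tree:
  assumes M: "bounds_chase M K" "finite M" and single: "\<And>\<rho>. \<rho> \<in> fst K \<Longrightarrow> branching \<rho> = 1"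
  shows "\<exists>T. is_chase_tree K T"
proof
  have stage_M: "snd K \<subseteq> stage n \<and> stage n \<subseteq> M" for n
  proof (induction n)
    case 0
    then show ?case using M by (simp add: bounds_chase_def)
  next
    case (Suc n)
    show ?case
    proof (cases "next_trigger (stage n)")
      case (Some t)
      from next_trigger_Some(1)[OF this] have t: "t \<in> triggers (fst K)" "loaded t (stage n)"
        "\<not> obsolete t (stage n)"
        by (auto simp: active_def)
      then have "\<forall>i\<in>{1..branching (fst t)}. out i t \<subseteq> M"
        using M(1) Suc unfolding bounds_chase_def by blast
      then have "out 1 t \<subseteq> M"
        using branching_pos[OF triggersD(3)[OF t(1)]] by simp
      with Suc Some show ?thesis by auto
    qed (use Suc in simp)
  qed
  \<comment> \<open>An output that is already present would make the trigger obsolete, so each step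
    adds a fact.\<close>
  have grow: "stage n \<subset> stage (Suc n)" if "next_trigger (stage n) = Some t" for n t
  proof -
    have t: "t \<in> triggers (fst K)" "\<not> obsolete t (stage n)"
      using next_trigger_Some(1)[OF that] by (simp_all add: active_def)
    then have "\<not> out 1 t \<subseteq> stage n"
      using obsolete_if_out_subset[of t 1] branching_pos[OF triggersD(3)[OF t(1)]] triggersD(1)[OF t(1)]
      by (metis atLeastAtMost_iff order_refl)
    with that show ?thesis by auto
  qed
  have "\<exists>n. next_trigger (stage n) = None"
  proof (rule ccontr)
    assume "\<not> ?thesis"
    then have "stage n \<subset> stage (Suc n)" for n
      using grow by (metis not_None_eq)
    then have "strict_mono stage"
      by (simp add: strict_mono_Suc_iff)
    \<comment> \<open>Endless growth would give infinitely many subsets of the finite set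
      \<open>M\<close>.\<close>
    then have "inj stage" by (rule strict_mono_imp_inj_on)
    moreover have "range stage \<subseteq> Pow M" using stage_M by blast
    ultimately show False
      using M(2) by (meson finite_Pow_iff finite_imageD finite_subset infinite_UNIV_nat)
  qed
  then obtain N where N: "next_trigger (stage N) = None" "\<And>i. i < N \<Longrightarrow> next_trigger (stage i) \<noteq> None"
    using exists_least_iff[of "\<lambda>n. next_trigger (stage n) = None"] by blast
  have vert: "vertices sequence_tree = {replicate n 1 | n. n \<le> N}"
  proof -
    have "(\<forall>i<n. next_trigger (stage i) \<noteq> None) \<longleftrightarrow> n \<le> N" for n
      using N by (meson leI less_le_trans)
    then show ?thesis by (simp add: sequence_tree_def)
  qed
  have vert_snoc: "v @ [i] \<in> vertices sequence_tree \<longleftrightarrow> v \<in> vertices sequence_tree \<and> length v < N \<and> i = 1" for v i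
  proof
    assume "v @ [i] \<in> vertices sequence_tree"
    then obtain n where n: "v @ [i] = replicate n 1" "n \<le> N" by (auto simp: vert)
    then obtain k where k: "n = Suc k" by (cases n) auto
    with n have "v @ [i] = replicate k 1 @ [1]" by (simp add: replicate_append_same)
    then show "v \<in> vertices sequence_tree \<and> length v < N \<and> i = 1" using n k by (auto simp: vert)
  next
    assume "v \<in> vertices sequence_tree \<and> length v < N \<and> i = 1"
    then obtain n where "v @ [i] = replicate (Suc n) 1" "Suc n \<le> N"
      by (auto simp: vert replicate_append_same)
    then show "v @ [i] \<in> vertices sequence_tree"
      unfolding vert by blast
  qed
  have sat: "obsolete t (stage N)" if "t \<in> triggers (fst K)" "loaded t (stage N)" for t
    using that N(1) unfolding next_trigger_None active_def by blast
  \<comment> \<open>Maximality forces every branch down to the leaf, where \<open>sat\<close>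
    settles all loaded triggers; this gives fairness.\<close>
  have branch_leaf: "replicate n 1 \<in> B" if B: "B \<in> branches sequence_tree" "n \<le> N" for B n
    using B(2)
  proof (induction n)
    case 0
    then show ?case using B(1) by (simp add: branches_def)
  next
    case (Suc n)
    then have "trg sequence_tree (replicate n 1) \<noteq> None" "replicate n 1 \<in> B"
      using N(2) by (auto simp: sequence_tree_def)
    then obtain i where "replicate n 1 @ [i] \<in> B"
      using B(1) unfolding branches_def by blast
    moreover from this have "i = 1"
      using B(1) vert_snoc unfolding branches_def by blast
    ultimately show ?case by (simp add: replicate_append_same)
  qed
  have flds: "label sequence_tree v = stage (length v)"
    "trg sequence_tree v = next_trigger (stage (length v))" for v
    by (simp_all add: sequence_tree_def)
  show "is_chase_tree K sequence_tree"
    unfolding is_chase_tree_def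
  proof (intro conjI ballI allI impI)
    show "[] \<in> vertices sequence_tree" by (simp add: vert)
    show "label sequence_tree [] = snd K" by (simp add: flds)
    show "v \<in> vertices sequence_tree" if "v @ [i] \<in> vertices sequence_tree" for v i
      using that vert_snoc by blast
  next
    fix v assume v: "v \<in> vertices sequence_tree"
    then have le: "length v \<le> N" by (auto simp: vert)
    show "case trg sequence_tree v of
        None \<Rightarrow> (\<forall>i. v @ [i] \<notin> vertices sequence_tree) \<and> (\<forall>\<rho>\<in>fst K. satisfied \<rho> (label sequence_tree v))
      | Some t \<Rightarrow>
          t \<in> triggers (fst K) \<and> loaded t (label sequence_tree v) \<and> \<not> obsolete t (label sequence_tree v) \<and>
          ((\<exists>t'\<in>triggers (fst K). datalog (fst t') \<and> loaded t' (label sequence_tree v) \<and>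
              \<not> obsolete t' (label sequence_tree v)) \<longrightarrow> datalog (fst t)) \<and>
          (\<forall>i. v @ [i] \<in> vertices sequence_tree \<longleftrightarrow> i \<in> {1..branching (fst t)}) \<and>
          (\<forall>i\<in>{1..branching (fst t)}. label sequence_tree (v @ [i]) = label sequence_tree v \<union> out i t)"
    proof (cases "trg sequence_tree v")
      case None
      then have "length v = N" using N(2) le by (metis flds(2) le_neq_implies_less)
      then show ?thesis
        using None sat vert_snoc by (auto simp: flds satisfied_def triggers_def)
    next
      case (Some t)
      then have nt: "next_trigger (stage (length v)) = Some t" by (simp add: flds)
      have t: "active (stage (length v)) t" using next_trigger_Some(1)[OF nt] .
      have "length v < N" using N(1) nt le by (metis le_neq_implies_less option.distinct(1))
      moreover have "branching (fst t) = 1"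
        using t single triggersD(2) by (auto simp: active_def)
      moreover have "datalog (fst t)" if "t'\<in>triggers (fst K)" "datalog (fst t')"
          "loaded t' (stage (length v))" "\<not> obsolete t' (stage (length v))" for t'
        using next_trigger_Some(2)[OF nt, of t'] that by (simp add: active_def)
      ultimately show ?thesis
        using Some t v nt by (auto simp: flds active_def vert_snoc)
    qed
  next
    fix B v t
    assume B: "B \<in> branches sequence_tree" and v: "v \<in> B" and t: "t \<in> triggers (fst K)"
      and "loaded t (label sequence_tree v)"
    moreover have "v \<in> vertices sequence_tree" using B v by (auto simp: branches_def)
    then have "stage (length v) \<subseteq> stage N" unfolding vert by (intro stage_mono) auto
    ultimately have "loaded t (stage N)" by (auto simp: flds intro: loaded_mono)
    from sat[OF t this] show "\<exists>u\<in>B. obsolete t (label sequence_tree u)"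
      using branch_leaf[OF B order_refl] by (auto simp: flds intro!: bexI[of _ "replicate N 1"])
  qed
qed

end

section \<open>Recursive functions\<close>

fun const_recf :: "nat \<Rightarrow> recf" where
  "const_recf 0 = Zero"
| "const_recf (Suc n) = Comp Succ [const_recf n]"

lemma reval_const_recf [simp]: "reval (const_recf n) xs = Some n"
  by (induction n) simp_all

definition add_recf :: recf where
  "add_recf = PrimRec (Proj 0) (Comp Succ [Proj 1])"

lemma reval_add_recf [simp]: "reval add_recf [m, n] = Some (m + n)"
  unfolding add_recf_def by (induction m) auto

text \<open>\<open>triangle (Suc n)\<close> is the successor of \<open>n + triangle n\<close>; in
  the step, \<open>Proj 0\<close> is \<open>n\<close> and \<open>Proj 1\<close> the previous
  value.\<close>

definition triangle_recf :: recf where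
  "triangle_recf = PrimRec Zero (Comp Succ [Comp add_recf [Proj 0, Proj 1]])"

lemma reval_triangle_recf [simp]: "reval triangle_recf [n] = Some (triangle n)"
  unfolding triangle_recf_def by (induction n) auto

text \<open>This is \<open>prod_encode\<close>: the triangle number of the sum, plus the first
  component.\<close>

definition pair_recf :: "recf \<Rightarrow> recf \<Rightarrow> recf" where
  "pair_recf f g = Comp add_recf [Comp triangle_recf [Comp add_recf [f, g]], f]"

lemma reval_pair_recf [simp]:
  assumes "reval f xs = Some m" "reval g xs = Some n"
  shows "reval (pair_recf f g) xs = Some (prod_encode (m, n))"
  using assms by (simp add: pair_recf_def prod_encode_def)

definition cons_recf :: "recf \<Rightarrow> recf \<Rightarrow> recf" where
  "cons_recf f g = Comp Succ [pair_recf f g]"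

lemma reval_cons_recf [simp]:
  assumes "reval f xs = Some m" "reval g xs = Some (list_encode ns)"
  shows "reval (cons_recf f g) xs = Some (list_encode (m # ns))"
  using assms by (simp add: cons_recf_def)


section \<open>The evaluation of recursive functions as a rule set\<close>

text \<open>A search increments its counter, which is recorded as a call to the successor function.\<close>

fun subcalls :: "recf \<Rightarrow> nat list \<Rightarrow> (recf \<times> nat list) set" where
  "subcalls (Comp f gs) xs =
     (\<lambda>g. (g, xs)) ` set gs \<union> {(f, ys) | ys. map (\<lambda>g. reval g xs) gs = map Some ys}"
| "subcalls (PrimRec f g) (0 # zs) = {(f, zs)}"
| "subcalls (PrimRec f g) (Suc n # zs) =
     insert (PrimRec f g, n # zs) {(g, n # y # zs) | y. reval (PrimRec f g) (n # zs) = Some y}"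
| "subcalls (Mu f) xs =
     {(f, n # xs) | n. \<forall>i<n. \<exists>y. reval f (i # xs) = Some (Suc y)} \<union>
     {(Succ, [n]) | n. \<forall>i\<le>n. \<exists>y. reval f (i # xs) = Some (Suc y)}"
| "subcalls _ _ = {}"

inductive called :: "recf \<Rightarrow> nat list \<Rightarrow> recf \<Rightarrow> nat list \<Rightarrow> bool" for f xs where
  refl: "called f xs f xs"
| step: "called f xs g ys \<Longrightarrow> (h, zs) \<in> subcalls g ys \<Longrightarrow> called f xs h zs"

abbreviation finitely_called :: "recf \<Rightarrow> nat list \<Rightarrow> bool" where
  "finitely_called f xs \<equiv> finite {(g, ys). called f xs g ys}"

text \<open>The call tree is finite if its root has finitely many children and the subtree of each
  child is finite.\<close>

lemma finitely_calledI:
  assumes "finite (subcalls f xs)" "\<And>g ys. (g, ys) \<in> subcalls f xs \<Longrightarrow> finitely_called g ys"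
  shows "finitely_called f xs"
proof (rule finite_subset)
  let ?C = "insert (f, xs) (\<Union>p\<in>subcalls f xs. {(h, zs). called (fst p) (snd p) h zs})"
  \<comment> \<open>\<open>called\<close> grows at its far end, so the induction shows that every
    call other than the root descends from a direct subcall of the root.\<close>
  have "(h, zs) \<in> ?C" if "called f xs h zs" for h zs
    using that
  proof induction
    case (step g ys h zs)
    show ?case
    proof (cases "(g, ys) = (f, xs)")
      case True
      then show ?thesis
        using step.hyps(2) by (intro insertI2 UN_I[of "(h, zs)"]) (simp_all add: called.refl)
    next
      case False
      then obtain g' ys' where "(g', ys') \<in> subcalls f xs" "called g' ys' g ys"
        using step.IH by auto
      then show ?thesis
        using called.step[OF _ step.hyps(2)] by (intro insertI2 UN_I[of "(g', ys')"]) simp_all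
    qed
  qed simp
  then show "{(g, ys). called f xs g ys} \<subseteq> ?C" by blast
  show "finite ?C" using assms by auto
qed

lemma reval_Comp_SomeE:
  assumes "reval (Comp f gs) xs = Some y"
  obtains ys where "map (\<lambda>g. reval g xs) gs = map Some ys" "reval f ys = Some y"
proof -
  have *: "None \<notin> set (map (\<lambda>g. reval g xs) gs)"
    and y: "reval f (map the (map (\<lambda>g. reval g xs) gs)) = Some y"
    using assms by (auto simp: Let_def split: if_splits)
  have "map (\<lambda>g. reval g xs) gs = map Some (map the (map (\<lambda>g. reval g xs) gs))"
    using * by (auto simp: image_iff)
  then show thesis using y that by blast
qed

lemma reval_Comp:
  assumes "map (\<lambda>g. reval g xs) gs = map Some ys"
  shows "reval (Comp f gs) xs = reval f ys"
  using assms by (auto simp: Let_def comp_def)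

lemma reval_PrimRec_Suc:
  "reval (PrimRec f g) (Suc n # zs) =
     (case reval (PrimRec f g) (n # zs) of None \<Rightarrow> None | Some y \<Rightarrow> reval g (n # y # zs))"
  by simp

text \<open>\<open>reval\<close> asks the earlier values only to be defined; the choice of the least
  zero makes them positive, the form in which the rules search.\<close>

lemma reval_Mu_iff:
  "reval (Mu f) xs = Some n \<longleftrightarrow>
     reval f (n # xs) = Some 0 \<and> (\<forall>i<n. \<exists>y. reval f (i # xs) = Some (Suc y))"
proof
  assume n: "reval f (n # xs) = Some 0 \<and> (\<forall>i<n. \<exists>y. reval f (i # xs) = Some (Suc y))"
  then have "(LEAST n. reval f (n # xs) = Some 0) = n"
    by (intro Least_equality) (auto, metis Suc_neq_Zero not_le option.inject)
  then show "reval (Mu f) xs = Some n" using n by fastforce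
next
  assume n: "reval (Mu f) xs = Some n"
  then obtain k where k: "reval f (k # xs) = Some 0" "\<forall>i<k. reval f (i # xs) \<noteq> None"
    and "n = (LEAST n. reval f (n # xs) = Some 0)"
    by (auto split: if_splits)
  then have 0: "reval f (n # xs) = Some 0" "n \<le> k" "\<And>i. i < n \<Longrightarrow> reval f (i # xs) \<noteq> Some 0"
    using LeastI[of "\<lambda>n. reval f (n # xs) = Some 0" k] Least_le[of "\<lambda>n. reval f (n # xs) = Some 0" k]
      not_less_Least[of _ "\<lambda>n. reval f (n # xs) = Some 0"] by blast+
  have "\<exists>y. reval f (i # xs) = Some (Suc y)" if "i < n" for i
    using k(2) 0(2) 0(3)[OF that] that by (metis not0_implies_Suc not_None_eq order.strict_trans2)
  with 0(1) show "reval f (n # xs) = Some 0 \<and> (\<forall>i<n. \<exists>y. reval f (i # xs) = Some (Suc y))"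
    by blast
qed

lemma finitely_called_Succ: "finitely_called Succ xs"
  by (rule finitely_calledI) simp_all

text \<open>Structural induction, with an inner induction on the recursion argument of
  \<open>PrimRec\<close>. Definedness passes to the subcalls, and the value of \<open>Mu\<close>
  bounds the search.\<close>

lemma finitely_called_if_defined:
  "reval f xs = Some y \<Longrightarrow> finitely_called f xs"
proof (induction f arbitrary: xs y)
  case (Comp f gs)
  obtain ys where ys: "map (\<lambda>g. reval g xs) gs = map Some ys" "reval f ys = Some y"
    using Comp.prems by (rule reval_Comp_SomeE)
  \<comment> \<open>The values of the \<open>gs\<close> determine the argument list, so
    \<open>f\<close> is called on one list only.\<close>
  have "{(f, ys') | ys'. map (\<lambda>g. reval g xs) gs = map Some ys'} = {(f, ys)}"
    using ys(1) by (auto simp: inj_map_eq_map)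
  then have sub: "subcalls (Comp f gs) xs = insert (f, ys) ((\<lambda>g. (g, xs)) ` set gs)"
    by simp
  have "\<exists>z. reval g xs = Some z" if "g \<in> set gs" for g
    using ys(1) that by (metis (no_types, lifting) ex_map_conv imageE image_eqI list.set_map)
  then have "finitely_called g xs" if "g \<in> set gs" for g
    using that Comp.IH(2) by blast
  moreover have "finitely_called f ys"
    using Comp.IH(1) ys(2) .
  ultimately have "finitely_called g' zs" if "(g', zs) \<in> subcalls (Comp f gs) xs" for g' zs
    using that unfolding sub by (elim insertE imageE) simp_all
  moreover have "finite (subcalls (Comp f gs) xs)"
    unfolding sub by simp
  ultimately show ?case
    by - (rule finitely_calledI)
next
  case (PrimRec f g)
  from PrimRec.prems obtain n zs where xs: "xs = n # zs" by (cases xs) auto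
  from PrimRec.prems show ?case unfolding xs
  proof (induction n arbitrary: y)
    case 0
    then show ?case using PrimRec.IH(1) by - (rule finitely_calledI, simp_all)
  next
    case (Suc n)
    then obtain z where z: "reval (PrimRec f g) (n # zs) = Some z" "reval g (n # z # zs) = Some y"
      unfolding reval_PrimRec_Suc by (auto split: option.splits)
    have sub: "subcalls (PrimRec f g) (Suc n # zs) = {(PrimRec f g, n # zs), (g, n # z # zs)}"
      using z(1) by (auto simp del: reval.simps)
    have "finitely_called g' ys" if "(g', ys) \<in> subcalls (PrimRec f g) (Suc n # zs)" for g' ys
      using that Suc.IH[OF z(1)] PrimRec.IH(2)[OF z(2)] unfolding sub by (elim insertE) simp_all
    moreover have "finite (subcalls (PrimRec f g) (Suc n # zs))"
      unfolding sub by simp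
    ultimately show ?case
      by - (rule finitely_calledI)
  qed
next
  case (Mu f)
  from Mu.prems have y: "reval f (y # xs) = Some 0" "\<forall>i<y. \<exists>z. reval f (i # xs) = Some (Suc z)"
    unfolding reval_Mu_iff by auto
  \<comment> \<open>A run of positive values cannot pass \<open>y\<close>, where the value is
    0.\<close>
  have le: "n \<le> y" if "\<forall>i<n. \<exists>z. reval f (i # xs) = Some (Suc z)" for n
    using that y(1) by (metis Suc_neq_Zero not_le option.inject)
  have "subcalls (Mu f) xs \<subseteq> (\<lambda>n. (f, n # xs)) ` {..y} \<union> (\<lambda>n. (Succ, [n])) ` {..y}"
    using le by (auto simp: less_imp_le)
  then have "finite (subcalls (Mu f) xs)" by (rule finite_subset) simp
  moreover have "\<exists>z. reval f (n # xs) = Some z" if "\<forall>i<n. \<exists>z. reval f (i # xs) = Some (Suc z)" for n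
    using le[OF that] y by (metis le_neq_implies_less)
  moreover have "finitely_called g ys" if "(g, ys) \<in> subcalls (Mu f) xs" for g ys
    using that Mu.IH finitely_called_Succ calculation(2) unfolding subcalls.simps by blast
  ultimately show ?case
    by - (rule finitely_calledI)
qed (rule finitely_calledI; simp)+

section \<open>The rules\<close>

abbreviation horn :: "nat atom list \<Rightarrow> nat atom \<Rightarrow> rule" where
  "horn bs a \<equiv> Rule bs [[a]]"

text \<open>The only rule that creates terms.  Its trigger on the numeral for \<open>n\<close> is obsolete once some
  successor of \<open>n\<close> is present, so every number is denoted by one term only.\<close>

definition succ_rule :: rule where
  "succ_rule = horn [satom (CallS Succ) [0]] (satom SuccS [0, 1])"

text \<open>The atom \<open>RetS f (y # xs)\<close> says that \<open>f\<close> has value \<open>y\<close> on \<open>xs\<close>, and \<open>SearchS f (n # xs)\<close>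
  that \<open>f\<close> is positive on \<open>i # xs\<close> for all \<open>i < n\<close>.\<close>

fun eval_rules :: "recf \<Rightarrow> nat \<Rightarrow> rule list" where
  "eval_rules Zero k =
     [horn [satom (CallS Zero) [0..<k], satom ZeroS [k]] (satom (RetS Zero) (k # [0..<k]))]"
| "eval_rules Succ k =
     [horn [satom (CallS Succ) [0], satom SuccS [0, 1]] (satom (RetS Succ) [1, 0])]"
| "eval_rules (Proj i) k =
     (if i < k then [horn [satom (CallS (Proj i)) [0..<k]] (satom (RetS (Proj i)) (i # [0..<k]))] else [])"
| "eval_rules (Comp f gs) k =
     (let n = length gs; xs = [0..<k]; ys = [k..<k + n];
        rets = map (\<lambda>i. satom (RetS (gs ! i)) ((k + i) # xs)) [0..<n]
      in map (\<lambda>g. horn [satom (CallS (Comp f gs)) xs] (satom (CallS g) xs)) gs @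
        [horn (satom (CallS (Comp f gs)) xs # rets) (satom (CallS f) ys),
         horn (satom (CallS (Comp f gs)) xs # satom (RetS f) ((k + n) # ys) # rets)
           (satom (RetS (Comp f gs)) ((k + n) # xs))] @
        eval_rules f n @ concat (map (\<lambda>g. eval_rules g k) gs))"
| "eval_rules (PrimRec f g) 0 = []"
| "eval_rules (PrimRec f g) (Suc k) =
     (let zs = [4..<4 + k]; c = satom (CallS (PrimRec f g)) (0 # zs); s = satom SuccS [1, 0];
        r = satom (RetS (PrimRec f g)) (2 # 1 # zs)
      in
        [horn [c, satom ZeroS [0]] (satom (CallS f) zs),
         horn [c, satom ZeroS [0], satom (RetS f) (2 # zs)] (satom (RetS (PrimRec f g)) (2 # 0 # zs)),
         horn [c, s] (satom (CallS (PrimRec f g)) (1 # zs)),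
         horn [c, s, r] (satom (CallS g) (1 # 2 # zs)),
         horn [c, s, r, satom (RetS g) (3 # 1 # 2 # zs)] (satom (RetS (PrimRec f g)) (3 # 0 # zs))] @
        eval_rules f k @ eval_rules g (Suc (Suc k)))"
| "eval_rules (Mu f) k =
     (let xs = [4..<4 + k]; a = satom (SearchS f) (0 # xs); r = satom (RetS f) (2 # 0 # xs)
      in
        [horn [satom (CallS (Mu f)) xs, satom ZeroS [0]] a,
         horn [a] (satom (CallS f) (0 # xs)),
         horn [a, r, satom ZeroS [2]] (satom (RetS (Mu f)) (0 # xs)),
         horn [a, r, satom SuccS [3, 2]] (satom (CallS Succ) [0]),
         horn [a, r, satom SuccS [3, 2], satom SuccS [0, 1]] (satom (SearchS f) (1 # xs))] @
        eval_rules f (Suc k))"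

text \<open>This makes the rules datalog and leaves the creation of terms to
  \<open>succ_rule\<close>.\<close>

lemma eval_rules_horn:
  "\<rho> \<in> set (eval_rules f k) \<Longrightarrow> \<exists>bs a. \<rho> = horn bs a \<and> bs \<noteq> [] \<and> vars [a] \<subseteq> vars bs"
proof (induction f k rule: eval_rules.induct)
  case (4 f gs k)
  \<comment> \<open>An argument variable of \<open>f\<close> is bound by the return atom of index
    \<open>x - k\<close>.\<close>
  have "\<exists>i\<in>{0..<length gs}. x = k + i" if "k \<le> x" "x < k + length gs" for x
    using that by (intro bexI[of _ "x - k"]) auto
  with 4 show ?case
    by (auto simp: Let_def vars_def)
qed (auto simp: Let_def vars_def split: if_splits)

definition datalog_program :: "recf \<Rightarrow> rule list" where
  "datalog_program h =
     [horn [satom StartS [0]] (satom (CallS h) [0]),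
      horn [satom StartS [0], satom (RetS h) [1, 0], satom ZeroS [1]] (satom GoalS [0])] @
     eval_rules h 1"

definition program :: "recf \<Rightarrow> rule list" where
  "program h = succ_rule # datalog_program h"

text \<open>The largest successor comes first, so that each step puts one fact in front;
  \<open>chain_recf\<close> computes the code in the same way.\<close>

primrec chain_facts :: "nat \<Rightarrow> fact list" where
  "chain_facts 0 = [satom ZeroS [Con 0]]"
| "chain_facts (Suc k) = satom SuccS [Con k, Con (Suc k)] # chain_facts k"

definition input_facts :: "nat \<Rightarrow> fact list" where
  "input_facts m = satom StartS [Con m] # chain_facts m"

lemma set_chain_facts:
  "set (chain_facts m) = insert (satom ZeroS [Con 0]) ((\<lambda>k. satom SuccS [Con k, Con (Suc k)]) ` {..<m})"
  by (induction m) (auto simp: lessThan_Suc)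

lemma datalog_program_horn:
  "\<rho> \<in> set (datalog_program h) \<Longrightarrow> \<exists>bs a. \<rho> = horn bs a \<and> bs \<noteq> [] \<and> vars [a] \<subseteq> vars bs"
  using eval_rules_horn by (auto simp: datalog_program_def vars_def)

lemma datalog_datalog_program: "\<rho> \<in> set (datalog_program h) \<Longrightarrow> datalog \<rho>"
  using datalog_program_horn by fastforce

lemma is_rule_program: "\<rho> \<in> set (program h) \<Longrightarrow> is_rule \<rho>"
  using datalog_program_horn by (fastforce simp: program_def succ_rule_def)

lemma branching_program: "\<rho> \<in> set (program h) \<Longrightarrow> branching \<rho> = 1"
  using datalog_program_horn by (fastforce simp: program_def succ_rule_def branching_def)


section \<open>The facts derivable by the program\<close>

text \<open>The numbers up to the input \<open>m\<close> are denoted by constants of the database, all others by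
  skolem terms.\<close>

primrec num :: "nat \<Rightarrow> nat \<Rightarrow> trm" where
  "num m 0 = Con 0"
| "num m (Suc k) = (if k < m then Con (Suc k) else Fn succ_rule 1 1 [num m k])"

lemma num_le: "k \<le> m \<Longrightarrow> num m k = Con k"
  by (cases k) auto

lemma num_eq_iff [simp]: "num m j = num m k \<longleftrightarrow> j = k"
proof
  show "num m j = num m k \<Longrightarrow> j = k"
  proof (induction j arbitrary: k)
    case 0
    then show ?case by (cases k) (auto split: if_splits)
  next
    case (Suc j)
    then show ?case by (cases k) (auto split: if_splits)
  qed
qed simp

declare num.simps [simp del]

lemma map_num_eq_iff [simp]: "map (num m) xs = map (num m) ys \<longleftrightarrow> xs = ys"
  by (rule inj_map_eq_map) (simp add: inj_def)

text \<open>The intended meaning of the predicates. Beyond the database, successors exist only where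
  \<open>Succ\<close> is called, which keeps the model finite when there are finitely many
  calls.\<close>

fun holds :: "recf \<Rightarrow> nat \<Rightarrow> symbol \<Rightarrow> trm list \<Rightarrow> bool" where
  "holds h m ZeroS ts \<longleftrightarrow> ts = [num m 0]"
| "holds h m SuccS ts \<longleftrightarrow>
     (\<exists>k. (k < m \<or> called h [m] Succ [k]) \<and> ts = [num m k, num m (Suc k)])"
| "holds h m StartS ts \<longleftrightarrow> ts = [num m m]"
| "holds h m GoalS ts \<longleftrightarrow> ts = [num m m] \<and> reval h [m] = Some 0"
| "holds h m (CallS f) ts \<longleftrightarrow> (\<exists>xs. called h [m] f xs \<and> ts = map (num m) xs)"
| "holds h m (RetS f) ts \<longleftrightarrow>
     (\<exists>xs y. called h [m] f xs \<and> reval f xs = Some y \<and> ts = num m y # map (num m) xs)"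
| "holds h m (SearchS f) ts \<longleftrightarrow>
     (\<exists>xs n. called h [m] (Mu f) xs \<and> (\<forall>i<n. \<exists>y. reval f (i # xs) = Some (Suc y)) \<and>
        ts = map (num m) (n # xs))"

definition model :: "recf \<Rightarrow> nat \<Rightarrow> fact set" where
  "model h m = {satom s ts | s ts. holds h m s ts}"

lemma satom_in_model [simp]: "satom s ts \<in> model h m \<longleftrightarrow> holds h m s ts"
  by (auto simp: model_def)

text \<open>Apart from the database chain and three single facts, every family of facts is an image
  of a set of calls: a value is determined by its call, and a search atom belongs to a call of the
  searched function.\<close>

lemma finite_model:
  assumes "finitely_called h [m]"
  shows "finite (model h m)"
proof -
  let ?C = "{(g, ys). called h [m] g ys}"
  have "finite {k. called h [m] Succ [k]}"
    by (rule finite_subset[OF _ finite_imageI[OF assms, of "\<lambda>(g, ys). hd ys"]]) force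
  then have "finite ({..<m} \<union> {k. called h [m] Succ [k]})"
    by simp
  moreover have "model h m \<subseteq> {satom ZeroS [num m 0], satom StartS [num m m], satom GoalS [num m m]} \<union>
      (\<lambda>k. satom SuccS [num m k, num m (Suc k)]) ` ({..<m} \<union> {k. called h [m] Succ [k]}) \<union>
      (\<lambda>(f, xs). satom (CallS f) (map (num m) xs)) ` ?C \<union>
      (\<lambda>(f, xs). satom (RetS f) (num m (the (reval f xs)) # map (num m) xs)) ` ?C \<union>
      (\<lambda>(f, xs). satom (SearchS f) (map (num m) xs)) ` ?C" (is "_ \<subseteq> ?F")
  proof
    fix a assume "a \<in> model h m"
    then obtain s ts where a: "a = satom s ts" "holds h m s ts" by (auto simp: model_def)
    show "a \<in> ?F"
    proof (cases s)
      case (RetS f)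
      with a obtain xs y where "called h [m] f xs" "reval f xs = Some y" "ts = num m y # map (num m) xs"
        by auto
      then have "a \<in> (\<lambda>(f, xs). satom (RetS f) (num m (the (reval f xs)) # map (num m) xs)) ` ?C"
        using a RetS by (intro image_eqI[of _ _ "(f, xs)"]) auto
      then show ?thesis by blast
    next
      case (CallS f)
      with a obtain xs where "called h [m] f xs" "ts = map (num m) xs"
        by auto
      then have "a \<in> (\<lambda>(f, xs). satom (CallS f) (map (num m) xs)) ` ?C"
        using a CallS by (intro image_eqI[of _ _ "(f, xs)"]) auto
      then show ?thesis by blast
    next
      case (SearchS f)
      with a obtain xs n where xs: "called h [m] (Mu f) xs" "ts = map (num m) (n # xs)"
        "\<forall>i<n. \<exists>y. reval f (i # xs) = Some (Suc y)"
        by auto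
      \<comment> \<open>A search that has reached the counter \<open>n\<close> calls
        \<open>f\<close> there.\<close>
      then have "called h [m] f (n # xs)"
        by (intro called.step[OF xs(1)]) auto
      then have "a \<in> (\<lambda>(f, xs). satom (SearchS f) (map (num m) xs)) ` ?C"
        using a SearchS xs(2) by (intro image_eqI[of _ _ "(f, n # xs)"]) auto
      then show ?thesis by blast
    qed (use a in auto)
  qed
  ultimately show ?thesis
    using assms by (auto intro: finite_subset)
qed

section \<open>Soundness of the rules\<close>

definition closed_under :: "rule \<Rightarrow> fact set \<Rightarrow> bool" where
  "closed_under \<rho> F \<longleftrightarrow>
     (\<forall>v. map_atom v ` set (body \<rho>) \<subseteq> F \<longrightarrow> map_atom v ` set (head 1 \<rho>) \<subseteq> F)"

lemma closed_under_horn: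
  "closed_under (horn bs a) F \<longleftrightarrow> (\<forall>v. map_atom v ` set bs \<subseteq> F \<longrightarrow> map_atom v a \<in> F)"
  by (simp add: closed_under_def)

text \<open>Serves both rules of \<open>Comp\<close> that read the values of all \<open>gs\<close>.
  The return atoms share \<open>xs\<close> with the call, so they concern the same argument list
  \<open>ws\<close>.\<close>

lemma model_closed_Comp:
  assumes "map_atom v (satom (CallS (Comp f gs)) xs) \<in> model h m"
    and "map_atom v ` set (map (\<lambda>i. satom (RetS (gs ! i)) ((k + i) # xs)) [0..<length gs]) \<subseteq> model h m"
  obtains ws ys where "map v xs = map (num m) ws" "called h [m] (Comp f gs) ws"
    "map (\<lambda>g. reval g ws) gs = map Some ys" "map v [k..<k + length gs] = map (num m) ys"
proof -
  from assms(1) obtain ws where ws: "map v xs = map (num m) ws" "called h [m] (Comp f gs) ws"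
    by auto
  have "\<exists>y. v (k + i) = num m y \<and> reval (gs ! i) ws = Some y" if "i < length gs" for i
    using assms(2) that by (auto simp: image_subset_iff ws(1))
  then obtain y where y: "\<And>i. i < length gs \<Longrightarrow> v (k + i) = num m (y i) \<and> reval (gs ! i) ws = Some (y i)"
    by metis
  show thesis
    by (rule that[OF ws, of "map y [0..<length gs]"]) (auto intro!: nth_equalityI simp: y)
qed

text \<open>Rules deriving a call follow \<open>subcalls\<close>, rules deriving a value follow an
  equation of \<open>reval\<close>. As \<open>num\<close> is injective, equal terms in a body stand
  for equal numbers.\<close>

lemma model_closed_eval_rules: "\<rho> \<in> set (eval_rules f k) \<Longrightarrow> closed_under \<rho> (model h m)"
proof (induction f k rule: eval_rules.induct)
  case (2 k)
  then show ?case by (auto simp: closed_under_horn)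
next
  case (3 i k)
  have "i < length xs \<and> v i = num m (xs ! i)" if "i < k" "map v [0..<k] = map (num m) xs" for v xs
    using that by (metis add_0 diff_zero length_map length_upt nth_map nth_upt)
  with 3 show ?case by (fastforce simp: closed_under_horn split: if_splits)
next
  case (4 f gs k)
  let ?n = "length gs" and ?xs = "[0..<k]" and ?ys = "[k..<k + length gs]"
  let ?c = "satom (CallS (Comp f gs)) ?xs"
  let ?rets = "map (\<lambda>i. satom (RetS (gs ! i)) ((k + i) # ?xs)) [0..<?n]"
  from 4(3) consider
      g where "g \<in> set gs" "\<rho> = horn [?c] (satom (CallS g) ?xs)"
    | "\<rho> = horn (?c # ?rets) (satom (CallS f) ?ys)"
    | "\<rho> = horn (?c # satom (RetS f) ((k + ?n) # ?ys) # ?rets) (satom (RetS (Comp f gs)) ((k + ?n) # ?xs))"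
    | "\<rho> \<in> set (eval_rules f ?n)"
    | g where "g \<in> set gs" "\<rho> \<in> set (eval_rules g k)"
    unfolding eval_rules.simps Let_def set_append set_map set_concat by auto
  then show ?case
  proof cases
    case (1 g)
    have "called h [m] g ws" if "called h [m] (Comp f gs) ws" for ws
      by (rule called.step[OF that]) (use 1 in auto)
    then show ?thesis unfolding 1 closed_under_horn by auto
  next
    case 2
    have "map_atom v (satom (CallS f) ?ys) \<in> model h m"
      if "map_atom v ` set (?c # ?rets) \<subseteq> model h m" for v
    proof -
      have "map_atom v ?c \<in> model h m" "map_atom v ` set ?rets \<subseteq> model h m"
        using that unfolding list.set by blast+
      then obtain ws ys where ws: "called h [m] (Comp f gs) ws"
        "map (\<lambda>g. reval g ws) gs = map Some ys" "map v ?ys = map (num m) ys"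
        by (rule model_closed_Comp)
      have "called h [m] f ys" by (rule called.step[OF ws(1)]) (use ws(2) in auto)
      then show ?thesis using ws(3) by auto
    qed
    then show ?thesis unfolding 2 closed_under_horn by blast
  next
    case 3
    have "map_atom v (satom (RetS (Comp f gs)) ((k + ?n) # ?xs)) \<in> model h m"
      if "map_atom v ` set (?c # satom (RetS f) ((k + ?n) # ?ys) # ?rets) \<subseteq> model h m" for v
    proof -
      have "map_atom v ?c \<in> model h m" "map_atom v ` set ?rets \<subseteq> model h m"
        and r: "map_atom v (satom (RetS f) ((k + ?n) # ?ys)) \<in> model h m"
        using that unfolding list.set by blast+
      from this(1,2) obtain ws ys where ws: "map v ?xs = map (num m) ws" "called h [m] (Comp f gs) ws"
        "map (\<lambda>g. reval g ws) gs = map Some ys" "map v ?ys = map (num m) ys"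
        by (rule model_closed_Comp)
      from r obtain z where "reval f ys = Some z" "v (k + ?n) = num m z"
        unfolding map_atom_satom list.map ws(4) by auto
      then show ?thesis
        using ws(1,2) reval_Comp[OF ws(3), of f] by (auto simp del: reval.simps)
    qed
    then show ?thesis unfolding 3 closed_under_horn by blast
  next
    case 4
    then show ?thesis using "4.IH" by auto
  next
    case (5 g)
    then show ?thesis using "4.IH" by auto
  qed
next
  case (6 f g k)
  let ?p = "PrimRec f g"
  have c0: "called h [m] f zs" if "called h [m] ?p (0 # zs)" for zs
    by (rule called.step[OF that]) simp
  have c1: "called h [m] ?p (n # zs)" if "called h [m] ?p (Suc n # zs)" for n zs
    by (rule called.step[OF that]) simp
  have c2: "called h [m] g (n # y # zs)"
    if "called h [m] ?p (Suc n # zs)" "reval ?p (n # zs) = Some y" for n y zs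
    by (rule called.step[OF that(1)]) (use that(2) in \<open>simp del: reval.simps\<close>)
  have r0: "reval ?p (0 # zs) = reval f zs" for zs
    by simp
  let ?zs = "[4..<4 + k]"
  let ?c = "satom (CallS ?p) (0 # ?zs)" and ?s = "satom SuccS [1, 0]"
    and ?r = "satom (RetS ?p) (2 # 1 # ?zs)"
  from 6(3) consider
      "\<rho> \<in> set [horn [?c, satom ZeroS [0]] (satom (CallS f) ?zs),
        horn [?c, satom ZeroS [0], satom (RetS f) (2 # ?zs)] (satom (RetS ?p) (2 # 0 # ?zs)),
        horn [?c, ?s] (satom (CallS ?p) (1 # ?zs)),
        horn [?c, ?s, ?r] (satom (CallS g) (1 # 2 # ?zs)),
        horn [?c, ?s, ?r, satom (RetS g) (3 # 1 # 2 # ?zs)] (satom (RetS ?p) (3 # 0 # ?zs))]"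
    | "\<rho> \<in> set (eval_rules f k)" | "\<rho> \<in> set (eval_rules g (Suc (Suc k)))"
    unfolding eval_rules.simps Let_def set_append by blast
  then show ?case
  proof cases
    case 1
    then show ?thesis
      unfolding list.set insert_iff
      by (elim disjE; auto simp: closed_under_horn Cons_eq_map_conv reval_PrimRec_Suc r0
          simp del: reval.simps dest: c0 c1 intro: c2)
  qed (use "6.IH" in auto)
next
  case (7 f k)
  have c1: "called h [m] f (n # xs)"
    if "called h [m] (Mu f) xs" "\<forall>i<n. \<exists>y. reval f (i # xs) = Some (Suc y)" for n xs
    by (rule called.step[OF that(1)]) (use that(2) in \<open>simp del: reval.simps\<close>)
  \<comment> \<open>The counter moves on only after a positive value, which is when
    \<open>subcalls\<close> lists \<open>Succ\<close>.\<close>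
  have c2: "called h [m] Succ [n]"
    if "called h [m] (Mu f) xs" "\<forall>i<n. \<exists>y. reval f (i # xs) = Some (Suc y)"
      "reval f (n # xs) = Some (Suc y)" for n y xs
    by (rule called.step[OF that(1)])
      (use that(2,3) in \<open>auto simp: le_less simp del: reval.simps\<close>)
  let ?xs = "[4..<4 + k]"
  let ?a = "satom (SearchS f) (0 # ?xs)" and ?r = "satom (RetS f) (2 # 0 # ?xs)"
  from 7(2) consider
      "\<rho> \<in> set [horn [satom (CallS (Mu f)) ?xs, satom ZeroS [0]] ?a,
        horn [?a] (satom (CallS f) (0 # ?xs)),
        horn [?a, ?r, satom ZeroS [2]] (satom (RetS (Mu f)) (0 # ?xs)),
        horn [?a, ?r, satom SuccS [3, 2]] (satom (CallS Succ) [0]),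
        horn [?a, ?r, satom SuccS [3, 2], satom SuccS [0, 1]] (satom (SearchS f) (1 # ?xs))]"
    | "\<rho> \<in> set (eval_rules f (Suc k))"
    unfolding eval_rules.simps Let_def set_append by blast
  then show ?case
  proof cases
    case 1
    then show ?thesis
      unfolding list.set insert_iff
      by (elim disjE; auto simp: closed_under_horn Cons_eq_map_conv reval_Mu_iff less_Suc_eq
          simp del: reval.simps intro: c1 c2)
  qed (use "7.IH" in auto)
qed (auto simp: closed_under_horn split: if_splits)

lemma model_closed_datalog_program:
  assumes "\<rho> \<in> set (datalog_program h)"
  shows "closed_under \<rho> (model h m)"
  using assms model_closed_eval_rules[of \<rho> h 1 h m]
  by (auto simp: datalog_program_def closed_under_horn Cons_eq_map_conv intro: called.refl exI[of _ "[m]"])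

lemma set_input_facts:
  "set (input_facts m) = {satom StartS [num m m], satom ZeroS [num m 0]} \<union>
     (\<lambda>k. satom SuccS [num m k, num m (Suc k)]) ` {..<m}"
  by (auto simp: input_facts_def set_chain_facts num_le)

lemma input_facts_subset_model: "set (input_facts m) \<subseteq> model h m"
  by (auto simp: set_input_facts)

lemma triggersE:
  assumes "t \<in> triggers R"
  obtains \<rho> \<sigma> where "t = (\<rho>, \<sigma>)" "\<rho> \<in> R" "dom \<sigma> = vars (body \<rho>)"
  using assms by (cases t) (auto simp: triggers_def is_trigger_def)

text \<open>Datalog steps stay inside by closure. For \<open>succ_rule\<close>, non-obsolescence is
  decisive: it excludes a skolem term as a second name of a number that the database denotes by a
  constant.\<close>

lemma model_bounds_chase: "bounds_chase (model h m) (set (program h), set (input_facts m))"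
proof -
  have "out i t \<subseteq> model h m"
    if t: "t \<in> triggers (set (program h))" and F: "set (input_facts m) \<subseteq> F" "F \<subseteq> model h m"
      and l: "loaded t F" and o: "\<not> obsolete t F" and i: "i \<in> {1..branching (fst t)}" for t F i
  proof -
    obtain \<rho> \<sigma> where \<rho>: "t = (\<rho>, \<sigma>)" "\<rho> \<in> set (program h)" "dom \<sigma> = vars (body \<rho>)"
      using t by (rule triggersE)
    have i: "i = 1" using i branching_program[OF \<rho>(2)] by (simp add: \<rho>(1))
    have bodyF: "map_atom (\<lambda>x. the (\<sigma> x)) ` set (body \<rho>) \<subseteq> F"
      using l loaded_iff[OF \<rho>(3)] by (simp add: \<rho>(1))
    consider "\<rho> \<in> set (datalog_program h)" | "\<rho> = succ_rule"
      using \<rho>(2) by (auto simp: program_def)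
    then show ?thesis
    proof cases
      case 1
      have "map_atom (\<lambda>x. the (\<sigma> x)) ` set (head 1 \<rho>) \<subseteq> model h m"
        using model_closed_datalog_program[OF 1] bodyF F(2) unfolding closed_under_def by blast
      then show ?thesis
        using out_datalog[OF datalog_datalog_program[OF 1] \<rho>(3)] by (simp add: i \<rho>(1))
    next
      case 2
      have dom: "dom \<sigma> = {0}" using \<rho>(3) by (simp add: 2 succ_rule_def vars_def)
      obtain k where k: "called h [m] Succ [k]" "the (\<sigma> 0) = num m k"
        using subset_trans[OF bodyF F(2)] by (auto simp: 2 succ_rule_def)
      have "0 \<in> dom \<sigma>" unfolding dom ..
      then have \<sigma>0: "\<sigma> 0 = Some (num m k)" using k(2) by (auto simp: dom_def)
      have "\<not> k < m"
      proof
        assume "k < m"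
        then have "satom SuccS [num m k, num m (Suc k)] \<in> F"
          using F(1) by (auto simp: set_input_facts)
        \<comment> \<open>The extension sends variable 0 to the numeral of \<open>k\<close> and the
          existential variable 1 to that of \<open>Suc k\<close>.\<close>
        moreover have "\<sigma> \<subseteq>\<^sub>m (\<lambda>x. Some (num m (k + x)))"
          using dom \<sigma>0 by (auto simp: map_le_def)
        ultimately have "obsolete t F"
          unfolding obsolete_def
          by (intro bexI[of _ 1] exI[of _ "\<lambda>x. Some (num m (k + x))"])
            (auto simp: \<rho>(1) 2 succ_rule_def branching_def head_def subst_atoms_def)
        with o show False ..
      qed
      moreover have "out 1 t = {satom SuccS [num m k, Fn succ_rule 1 1 [num m k]]}"
      proof -
        have "vars (body succ_rule) = {0}" "head 1 succ_rule = [satom SuccS [0, 1]]"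
          "frontier succ_rule = {0}"
          by (auto simp: succ_rule_def vars_def frontier_def)
        then show ?thesis
          by (simp add: \<rho>(1) 2 out_eq sk_var_def \<sigma>0)
      qed
      ultimately show ?thesis
        using k(1) by (auto simp: i num.simps)
    qed
  qed
  then show ?thesis
    using input_facts_subset_model by (auto simp: bounds_chase_def)
qed


section \<open>Completeness of the program\<close>

text \<open>Assignments will be written as \<open>(!) ts\<close>, variable \<open>i\<close> standing
  for the entry at position \<open>i\<close>; consecutive variables then yield a segment of the
  list.\<close>

lemma map_nth_append_upt:
  "length ts = i \<Longrightarrow> map ((!) (ts @ us @ ws)) [i..<i + length us] = us"
  by (rule nth_equalityI) (auto simp: nth_append)

text \<open>For the rules that reserve the variables 0 to 3 and number the parameters from
  4.\<close>

lemma map_nth_upt_4: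
  "map ((!) (a # b # c # d # us)) [4..<4 + length us] = us"
  using map_nth_append_upt[of "[a, b, c, d]" 4 us "[]"] by simp

text \<open>Primitive recursion descends along these facts, and a search recognises a positive value
  by the last of them.\<close>

definition reaches :: "fact set \<Rightarrow> nat \<Rightarrow> nat \<Rightarrow> bool" where
  "reaches U m n \<longleftrightarrow> (\<forall>k<n. satom SuccS [num m k, num m (Suc k)] \<in> U)"

lemma reaches_0 [simp]: "reaches U m 0"
  by (simp add: reaches_def)

lemma reaches_Suc [simp]:
  "reaches U m (Suc n) \<longleftrightarrow> reaches U m n \<and> satom SuccS [num m n, num m (Suc n)] \<in> U"
  by (auto simp: reaches_def less_Suc_eq)

text \<open>Structural induction on \<open>f\<close>. \<open>reaches\<close> is carried along for
  arguments and values alike, since values become arguments of later calls.\<close>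

lemma eval_rules_complete:
  assumes closed: "\<And>\<rho>. \<rho> \<in> R \<Longrightarrow> closed_under \<rho> U"
    and succ: "\<And>n. satom (CallS Succ) [num m n] \<in> U \<Longrightarrow> satom SuccS [num m n, num m (Suc n)] \<in> U"
    and zero: "satom ZeroS [num m 0] \<in> U"
  shows "set (eval_rules f (length xs)) \<subseteq> R \<Longrightarrow> satom (CallS f) (map (num m) xs) \<in> U \<Longrightarrow>
    list_all (reaches U m) xs \<Longrightarrow> reval f xs = Some y \<Longrightarrow>
    satom (RetS f) (num m y # map (num m) xs) \<in> U \<and> reaches U m y"
proof (induction f arbitrary: xs y)
  have fire: "map_atom v a \<in> U" if "horn bs a \<in> R" "map_atom v ` set bs \<subseteq> U" for bs a v
    using closed[OF that(1)] that(2) by (simp add: closed_under_horn)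
  {
    case Zero
    let ?v = "(!) (map (num m) xs @ [num m 0])"
    have v: "map ?v [0..<length xs] = map (num m) xs" "?v (length xs) = num m 0"
      using map_nth_append_upt[of "[]" 0 "map (num m) xs"] by (simp_all add: nth_append)
    have "map_atom ?v (satom (RetS Zero) (length xs # [0..<length xs])) \<in> U"
      by (rule fire[of "[satom (CallS Zero) [0..<length xs], satom ZeroS [length xs]]"])
        (use Zero zero in \<open>auto simp: v\<close>)
    then show ?case using Zero v by simp
  next
    case Succ
    then obtain x where x: "xs = [x]" "y = Suc x"
      by (auto split: list.splits)
    have s: "satom SuccS [num m x, num m (Suc x)] \<in> U"
      using Succ.prems(2) by (intro succ) (simp add: x)
    have "map_atom ((!) [num m x, num m (Suc x)]) (satom (RetS Succ) [1, 0]) \<in> U"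
      by (rule fire[of "[satom (CallS Succ) [0], satom SuccS [0, 1]]"])
        (use Succ s in \<open>auto simp: x\<close>)
    then show ?case using Succ x s by simp
  next
    case (Proj i)
    then have i: "i < length xs" "y = xs ! i"
      by (auto split: if_splits)
    let ?v = "(!) (map (num m) xs)"
    have v: "map ?v [0..<length xs] = map (num m) xs"
      using map_nth_append_upt[of "[]" 0 "map (num m) xs" "[]"] by simp
    have "map_atom ?v (satom (RetS (Proj i)) (i # [0..<length xs])) \<in> U"
      by (rule fire[of "[satom (CallS (Proj i)) [0..<length xs]]"])
        (use Proj i in \<open>auto simp: v\<close>)
    then show ?case using Proj.prems(3) v i by (auto simp: list_all_length)
  next
    case (Comp f gs)
    obtain ys where ys: "map (\<lambda>g. reval g xs) gs = map Some ys" "reval f ys = Some y"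
      using Comp.prems(4) by (rule reval_Comp_SomeE)
    have len: "length ys = length gs" using ys(1) by (metis length_map)
    let ?k = "length xs" and ?n = "length gs"
    \<comment> \<open>The variables stand for the arguments, then the values of the
      \<open>gs\<close>, then the value of \<open>f\<close>, as numbered in
      \<open>eval_rules\<close>.\<close>
    let ?v = "(!) (map (num m) xs @ map (num m) ys @ [num m y])"
    let ?c = "satom (CallS (Comp f gs)) [0..<?k]" and ?ys = "[?k..<?k + ?n]"
    let ?rets = "map (\<lambda>i. satom (RetS (gs ! i)) ((?k + i) # [0..<?k])) [0..<?n]"
    have v: "map ?v [0..<?k] = map (num m) xs" "map ?v ?ys = map (num m) ys"
      "?v (?k + ?n) = num m y" "\<And>i. i < ?n \<Longrightarrow> ?v (?k + i) = num m (ys ! i)"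
      using map_nth_append_upt[of "[]" 0 "map (num m) xs" "map (num m) ys @ [num m y]"]
        map_nth_append_upt[of "map (num m) xs" ?k "map (num m) ys" "[num m y]"]
      by (simp_all add: nth_append len)
    have c: "map_atom ?v ?c \<in> U" using Comp.prems(2) v(1) by simp
    have R: "horn [?c] (satom (CallS g) [0..<?k]) \<in> R" "set (eval_rules g ?k) \<subseteq> R" if "g \<in> set gs" for g
      using Comp.prems(1) that by (auto simp: Let_def)
    have Rf: "horn (?c # ?rets) (satom (CallS f) ?ys) \<in> R"
      "horn (?c # satom (RetS f) ((?k + ?n) # ?ys) # ?rets) (satom (RetS (Comp f gs)) ((?k + ?n) # [0..<?k])) \<in> R"
      "set (eval_rules f (length ys)) \<subseteq> R"
      using Comp.prems(1) by (auto simp: Let_def len)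
    have ret: "satom (RetS (gs ! i)) (num m (ys ! i) # map (num m) xs) \<in> U \<and> reaches U m (ys ! i)"
      if i: "i < ?n" for i
    proof (rule Comp.IH(2))
      show "gs ! i \<in> set gs" using i by simp
      then show "set (eval_rules (gs ! i) ?k) \<subseteq> R" using R by simp
      have "map_atom ?v (satom (CallS (gs ! i)) [0..<?k]) \<in> U"
        by (rule fire[OF R(1)]) (use i c in auto)
      then show "satom (CallS (gs ! i)) (map (num m) xs) \<in> U" by (simp add: v(1))
      show "reval (gs ! i) xs = Some (ys ! i)"
        using ys(1) i len by (metis (no_types, lifting) nth_map)
    qed (use Comp.prems in simp)
    then have rets: "map_atom ?v ` set ?rets \<subseteq> U"
      by (auto simp: v(1) v(4)[simplified])
    have "map_atom ?v (satom (CallS f) ?ys) \<in> U"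
      by (rule fire[OF Rf(1)]) (use c rets in simp)
    then have f: "satom (RetS f) (num m y # map (num m) ys) \<in> U \<and> reaches U m y"
      using ret by (intro Comp.IH(1) Rf(3) ys(2)) (auto simp: v(2) list_all_length len)
    have "map_atom ?v (satom (RetS (Comp f gs)) ((?k + ?n) # [0..<?k])) \<in> U"
      by (rule fire[OF Rf(2)]) (use c rets f v(2,3) in simp)
    then show ?case using f v(1,3) by simp
  next
    case (PrimRec f g)
    from PrimRec.prems obtain n zs where xs: "xs = n # zs" by (cases xs) auto
    let ?p = "PrimRec f g" and ?zs = "[4..<4 + length zs]"
    let ?c = "satom (CallS ?p) (0 # ?zs)" and ?s = "satom SuccS [1, 0]"
      and ?r = "satom (RetS ?p) (2 # 1 # ?zs)"
    have R: "horn [?c, satom ZeroS [0]] (satom (CallS f) ?zs) \<in> R"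
      "horn [?c, satom ZeroS [0], satom (RetS f) (2 # ?zs)] (satom (RetS ?p) (2 # 0 # ?zs)) \<in> R"
      "horn [?c, ?s] (satom (CallS ?p) (1 # ?zs)) \<in> R"
      "horn [?c, ?s, ?r] (satom (CallS g) (1 # 2 # ?zs)) \<in> R"
      "horn [?c, ?s, ?r, satom (RetS g) (3 # 1 # 2 # ?zs)] (satom (RetS ?p) (3 # 0 # ?zs)) \<in> R"
      "set (eval_rules f (length zs)) \<subseteq> R" "set (eval_rules g (length (n # y # zs))) \<subseteq> R" for n y
      using PrimRec.prems(1) by (simp_all add: Let_def xs)
    let ?v = "\<lambda>a b c d. (!) (num m a # num m b # num m c # num m d # map (num m) zs)"
    have v: "map (?v a b c d) ?zs = map (num m) zs" for a b c d
      using map_nth_upt_4[of _ _ _ _ "map (num m) zs"] by simp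
    from PrimRec.prems(2-4) show ?case unfolding xs
    proof (induction n arbitrary: y)
      case 0
      then have y: "reval f zs = Some y" by simp
      have "map_atom (?v 0 0 y 0) (satom (CallS f) ?zs) \<in> U"
        by (rule fire[OF R(1)]) (use 0 zero v in simp)
      then have f: "satom (RetS f) (num m y # map (num m) zs) \<in> U \<and> reaches U m y"
        by (intro PrimRec.IH(1) R y) (use 0 v in simp_all)
      have "map_atom (?v 0 0 y 0) (satom (RetS ?p) (2 # 0 # ?zs)) \<in> U"
        by (rule fire[OF R(2)]) (use 0 zero v f in simp)
      then show ?case using f v by simp
    next
      case (Suc n)
      obtain z where z: "reval ?p (n # zs) = Some z" "reval g (n # z # zs) = Some y"
        using Suc.prems(3) unfolding reval_PrimRec_Suc by (auto split: option.splits)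
      \<comment> \<open>Variables 0 to 3: the argument, its predecessor, the value at the
        predecessor, the value at the argument.\<close>
      let ?w = "?v (Suc n) n z y"
      have c: "map_atom ?w ?c \<in> U" and s: "map_atom ?w ?s \<in> U"
        using Suc.prems(1,2) v by simp_all
      have "map_atom ?w (satom (CallS ?p) (1 # ?zs)) \<in> U"
        by (rule fire[OF R(3)]) (use c s in simp)
      then have p: "satom (RetS ?p) (num m z # map (num m) (n # zs)) \<in> U \<and> reaches U m z"
        by (intro Suc.IH z(1)) (use Suc.prems(2) v in simp_all)
      then have r: "map_atom ?w ?r \<in> U" using v by simp
      have "map_atom ?w (satom (CallS g) (1 # 2 # ?zs)) \<in> U"
        by (rule fire[OF R(4)]) (use c s r in simp)
      then have g: "satom (RetS g) (num m y # map (num m) (n # z # zs)) \<in> U \<and> reaches U m y"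
        by (intro PrimRec.IH(2) R z(2)) (use Suc.prems(2) p v in simp_all)
      have "map_atom ?w (satom (RetS ?p) (3 # 0 # ?zs)) \<in> U"
        by (rule fire[OF R(5)]) (use c s r g v in simp)
      then show ?case using g v by simp
    qed
  next
    case (Mu f)
    from Mu.prems(4) have y: "reval f (y # xs) = Some 0"
      and pos: "\<And>i. i < y \<Longrightarrow> \<exists>z. reval f (i # xs) = Some (Suc z)"
      unfolding reval_Mu_iff by auto
    let ?xs = "[4..<4 + length xs]"
    let ?a = "satom (SearchS f) (0 # ?xs)" and ?r = "satom (RetS f) (2 # 0 # ?xs)"
    have R: "horn [satom (CallS (Mu f)) ?xs, satom ZeroS [0]] ?a \<in> R"
      "horn [?a] (satom (CallS f) (0 # ?xs)) \<in> R"
      "horn [?a, ?r, satom ZeroS [2]] (satom (RetS (Mu f)) (0 # ?xs)) \<in> R"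
      "horn [?a, ?r, satom SuccS [3, 2]] (satom (CallS Succ) [0]) \<in> R"
      "horn [?a, ?r, satom SuccS [3, 2], satom SuccS [0, 1]] (satom (SearchS f) (1 # ?xs)) \<in> R"
      "set (eval_rules f (length (n # xs))) \<subseteq> R" for n
      using Mu.prems(1) by (simp_all add: Let_def)
    let ?v = "\<lambda>a b c d. (!) (num m a # num m b # num m c # num m d # map (num m) xs)"
    have v: "map (?v a b c d) ?xs = map (num m) xs" for a b c d
      using map_nth_upt_4[of _ _ _ _ "map (num m) xs"] by simp
    have ret: "satom (RetS f) (num m z # map (num m) (n # xs)) \<in> U \<and> reaches U m z"
      if "satom (SearchS f) (map (num m) (n # xs)) \<in> U" "reaches U m n" "reval f (n # xs) = Some z" for n z
    proof -
      \<comment> \<open>Besides the parameters, this rule contains only variable 0; the other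
        entries are fillers.\<close>
      have "map_atom (?v n n n n) (satom (CallS f) (0 # ?xs)) \<in> U"
        by (rule fire[OF R(2)]) (use that(1) v in simp)
      then show ?thesis
        by (intro Mu.IH R that(3)) (use that(2) Mu.prems(3) v in simp_all)
    qed
    have search: "satom (SearchS f) (map (num m) (n # xs)) \<in> U \<and> reaches U m n" if "n \<le> y" for n
      using that
    proof (induction n)
      case 0
      have "map_atom (?v 0 0 0 0) ?a \<in> U"
        by (rule fire[OF R(1)]) (use Mu.prems(2) zero v in simp)
      then show ?case using v by simp
    next
      case (Suc n)
      then obtain z where z: "reval f (n # xs) = Some (Suc z)" using pos[of n] by auto
      \<comment> \<open>Variables 0 to 3: the counter, the next counter, the positive value found,
        its predecessor.\<close>
      let ?w = "?v n (Suc n) (Suc z) z"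
      have a: "map_atom ?w ?a \<in> U" using Suc v by simp
      have r: "satom (RetS f) (num m (Suc z) # map (num m) (n # xs)) \<in> U \<and> reaches U m (Suc z)"
        using Suc by (intro ret z) simp_all
      then have r': "map_atom ?w ?r \<in> U" "map_atom ?w (satom SuccS [3, 2]) \<in> U" using v by simp_all
      \<comment> \<open>The call of \<open>Succ\<close> requests a term for the next counter;
        \<open>succ\<close> then supplies it.\<close>
      have "map_atom ?w (satom (CallS Succ) [0]) \<in> U"
        by (rule fire[OF R(4)]) (use a r' in simp)
      then have s: "satom SuccS [num m n, num m (Suc n)] \<in> U" by (intro succ) simp
      have "map_atom ?w (satom (SearchS f) (1 # ?xs)) \<in> U"
        by (rule fire[OF R(5)]) (use a r' s in simp)
      then show ?case using Suc s v by simp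
    qed
    have "satom (RetS f) (num m 0 # map (num m) (y # xs)) \<in> U"
      using search[of y] ret[OF _ _ y] by simp
    then have "map_atom (?v y 0 0 0) (satom (RetS (Mu f)) (0 # ?xs)) \<in> U"
      by (intro fire[OF R(3)]) (use search[of y] zero v in simp)
    then show ?case using search[of y] v by simp
  }
qed


section \<open>Undecidability\<close>

definition query_rule :: rule where
  "query_rule = horn [satom StartS [0]] (satom GoalS [0])"

lemma is_head_choice_Nil: "is_head_choice (hc_of [])"
  using branching_pos by (simp add: is_head_choice_def hc_of_def)

lemma is_kb_program: "is_kb (set (program h), set (input_facts m))"
  by (auto simp: is_kb_def is_rule_program function_free_def input_facts_def set_chain_facts)

lemma vars_body_query_rule: "vars (body query_rule) = {0}"
  by (simp add: query_rule_def vars_def)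

lemma is_trigger_query: "is_trigger (query_rule, map_of [(0, Con m)])"
  by (simp add: is_trigger_def vars_body_query_rule) (simp add: query_rule_def)

lemma loaded_query: "loaded (query_rule, map_of [(0, Con m)]) F \<longleftrightarrow> satom StartS [Con m] \<in> F"
  by (subst loaded_iff) (simp_all add: vars_body_query_rule, simp add: query_rule_def)

lemma out_query: "out_hc (hc_of []) (query_rule, map_of [(0, Con m)]) = {satom GoalS [Con m]}"
proof -
  have "datalog query_rule" by (simp add: query_rule_def vars_def)
  then have "out 1 (query_rule, map_of [(0, Con m)]) = {satom GoalS [Con m]}"
    by (subst out_datalog) (simp_all add: vars_body_query_rule, simp add: query_rule_def)
  then show ?thesis by (simp add: out_hc_def hc_of_def)
qed

text \<open>Completeness is applied to \<open>result\<close>, which fairness closes under the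
  datalog rules in every chase tree.\<close>

lemma goal_derived:
  assumes "reval h [m] = Some 0"
    and T: "is_chase_tree (set (program h), set (input_facts m)) T"
  shows "satom GoalS [Con m] \<in> result T (hc_of [])"
proof -
  let ?hc = "hc_of []"
  let ?U = "result T ?hc"
  note hc = is_head_choice_Nil
  have U_model: "?U \<subseteq> model h m"
    using label_subset_bound[OF T model_bounds_chase] branch_subset_vertices[OF T hc]
    by (auto simp: result_def)
  have input: "set (input_facts m) \<subseteq> ?U"
    using chase_treeD(2)[OF T] branch.root unfolding result_def by fastforce
  have closed: "closed_under \<rho> ?U" if "\<rho> \<in> set (datalog_program h)" for \<rho>
    using that result_closed_datalog[OF T hc, of \<rho>] datalog_datalog_program[OF that]
      is_rule_program[of \<rho> h]
    by (simp add: closed_under_def program_def)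
  \<comment> \<open>Fairness for \<open>succ_rule\<close> yields only some successor of
    \<open>n\<close>. Soundness identifies it as \<open>num m (Suc n)\<close>, because the result
    lies in the model.\<close>
  have succ: "satom SuccS [num m n, num m (Suc n)] \<in> ?U" if call: "satom (CallS Succ) [num m n] \<in> ?U" for n
  proof -
    define \<sigma> where "\<sigma> = (\<lambda>x. if x \<in> vars (body succ_rule) then Some (num m n) else None)"
    have "succ_rule \<in> fst (set (program h), set (input_facts m))" "is_rule succ_rule"
      by (simp_all add: program_def succ_rule_def)
    moreover have "map_atom (\<lambda>_. num m n) ` set (body succ_rule) \<subseteq> ?U"
      using call by (simp add: succ_rule_def)
    ultimately have "\<exists>u\<in>branch T ?hc. obsolete (succ_rule, \<sigma>) (label T u)"
      using \<sigma>_def by (rule result_obsolete(2)[OF T hc])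
    then obtain \<sigma>' where le: "\<sigma> \<subseteq>\<^sub>m \<sigma>'"
      and sub: "satom SuccS [subst_trm \<sigma>' (Var 0), subst_trm \<sigma>' (Var 1)] \<in> ?U"
      by (auto simp: obsolete_def succ_rule_def branching_def head_def subst_atoms_def result_def
          simp del: subst_trm.simps)
    have "\<sigma> 0 = Some (num m n)" by (simp add: \<sigma>_def succ_rule_def vars_def)
    then have "\<sigma>' 0 = Some (num m n)" using le by (metis domI map_le_def)
    moreover from sub U_model obtain k where
      "[subst_trm \<sigma>' (Var 0), subst_trm \<sigma>' (Var 1)] = [num m k, num m (Suc k)]"
      by (auto simp del: subst_trm.simps dest!: subsetD)
    ultimately show ?thesis using sub by simp
  qed
  have fire: "map_atom v a \<in> ?U" if "horn bs a \<in> set (datalog_program h)" "map_atom v ` set bs \<subseteq> ?U" for bs a v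
    using closed[OF that(1)] that(2) by (simp add: closed_under_horn)
  have start: "satom StartS [Con m] \<in> ?U" and zero: "satom ZeroS [Con 0] \<in> ?U"
    using input by (auto simp: input_facts_def set_chain_facts)
  have "map_atom (\<lambda>_ :: nat. Con m) (satom (CallS h) [0]) \<in> ?U"
    by (rule fire[of "[satom StartS [0]]"]) (use start in \<open>auto simp: datalog_program_def\<close>)
  then have "satom (RetS h) (num m 0 # map (num m) [m]) \<in> ?U \<and> reaches ?U m 0"
  proof (intro eval_rules_complete[OF closed succ])
    show "satom ZeroS [num m 0] \<in> ?U" using zero by (simp add: num_le)
    show "set (eval_rules h (length [m])) \<subseteq> set (datalog_program h)"
      by (auto simp: datalog_program_def)
    show "list_all (reaches ?U m) [m]"
      using input by (auto simp: reaches_def set_input_facts)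
  qed (use assms(1) in \<open>simp_all add: num_le\<close>)
  then have "map_atom ((!) [Con m, Con 0]) (satom GoalS [0]) \<in> ?U"
    by (intro fire[of "[satom StartS [0], satom (RetS h) [1, 0], satom ZeroS [1]]" "satom GoalS [0]"])
      (use start zero in \<open>auto simp: datalog_program_def num_le\<close>)
  then show ?thesis by simp
qed

text \<open>If \<open>y = 0\<close>, every chase tree derives the goal. Conversely, g-unblockability
  would be vacuous without a chase tree; definedness of \<open>h\<close> makes the model finite and
  so provides one, and by soundness its goal fact forces \<open>y = 0\<close>.\<close>

lemma g_unblockable_query_iff:
  assumes y: "reval h [m] = Some y"
  shows "g_unblockable (query_rule, map_of [(0, Con m)])
      (set (program h), set (input_facts m)) (hc_of []) \<longleftrightarrow> y = 0" (is "g_unblockable ?t ?K ?hc \<longleftrightarrow> _")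
proof
  assume "y = 0"
  then show "g_unblockable ?t ?K ?hc"
    using goal_derived[of h m] y unfolding g_unblockable_def out_query result_def by fastforce
next
  assume g: "g_unblockable ?t ?K ?hc"
  have "finite (model h m)"
    using finite_model finitely_called_if_defined[OF y] .
  then obtain T where T: "is_chase_tree ?K T"
    using ex_chase_tree[OF model_bounds_chase] branching_program by fastforce
  have "loaded ?t (label T [])"
    using chase_treeD(2)[OF T] unfolding loaded_query by (simp add: input_facts_def)
  with g T obtain u where "u \<in> branch T ?hc" "satom GoalS [Con m] \<in> label T u"
    unfolding g_unblockable_def out_query using branch.root by blast
  then have "satom GoalS [Con m] \<in> model h m"
    using label_subset_bound[OF T model_bounds_chase] branch_subset_vertices[OF T is_head_choice_Nil]
    by blast
  with y show "y = 0" by simp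
qed

section \<open>Computing the code of the diagonal instance\<close>

definition chain_recf :: recf where
  "chain_recf = PrimRec (const_recf (list_encode (map (enc_atom enc_trm) (chain_facts 0))))
     (cons_recf
       (pair_recf (const_recf (to_nat SuccS))
         (cons_recf (pair_recf (const_recf 1) (Proj 0))
           (cons_recf (pair_recf (const_recf 1) (Comp Succ [Proj 0])) (const_recf (list_encode [])))))
       (Proj 1))"

lemma enc_atom_satom: "enc_atom e (satom s ts) = prod_encode (to_nat s, list_encode (map e ts))"
  by (simp add: enc_atom_def satom_def)

text \<open>In the recursion, \<open>Proj 0\<close> is the current number and \<open>Proj 1\<close>
  the code of the shorter list; the constant 1 in the pairs is the tag of \<open>Con\<close> in
  \<open>enc_trm\<close>.\<close>

lemma reval_chain_recf:
  "reval chain_recf [m] = Some (list_encode (map (enc_atom enc_trm) (chain_facts m)))"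
proof (induction m)
  case 0
  then show ?case by (simp add: chain_recf_def del: chain_facts.simps)
next
  case (Suc m)
  then show ?case unfolding chain_recf_def reval_PrimRec_Suc
    by (simp add: enc_atom_satom del: list_encode.simps reval.simps(5))
qed

text \<open>The instance asks whether the program with the code \<open>m\<close> derives the goal from the input \<open>m\<close>.\<close>

definition diagonal_recf :: recf where
  "diagonal_recf = pair_recf (Proj 0)
     (pair_recf
       (cons_recf
         (pair_recf (const_recf (to_nat StartS))
           (cons_recf (pair_recf (const_recf 1) (Proj 0)) (const_recf (list_encode []))))
         chain_recf)
       (pair_recf (const_recf (list_encode []))
         (pair_recf (const_recf (enc_rule query_rule))
           (cons_recf (pair_recf (const_recf 0) (pair_recf (const_recf 1) (Proj 0)))
             (const_recf (list_encode []))))))"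

text \<open>\<open>m\<close> serves twice: copied unchanged as the code of the rule list, and as the
  number put into the input facts and the substitution.\<close>

lemma reval_diagonal_recf:
  assumes "m = list_encode (map enc_rule rs)"
  shows "reval diagonal_recf [m] = Some (enc_instance (rs, input_facts m, [], query_rule, [(0, Con m)]))"
  by (simp add: diagonal_recf_def reval_chain_recf input_facts_def enc_atom_satom
      del: list_encode.simps reval.simps(5)) (simp add: assms)

theorem theorem2:
  shows "\<not> decidable {enc_instance (rs, fs, hcs, \<rho>, s) | rs fs hcs \<rho> s.
           is_kb (set rs, set fs) \<and> is_head_choice (hc_of hcs) \<and> is_trigger (\<rho>, map_of s) \<and>
           g_unblockable (\<rho>, map_of s) (set rs, set fs) (hc_of hcs)}"
    (is "\<not> decidable ?A")
proof
  assume "decidable ?A"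
  then obtain d where d: "\<And>n. reval d [n] = Some (if n \<in> ?A then 1 else 0)"
    unfolding decidable_def by blast
  define h where "h = Comp d [diagonal_recf]"
  define m where "m = list_encode (map enc_rule (program h))"
  let ?I = "(program h, input_facts m, [], query_rule, [(0, Con m)]) :: instance_data"
  have "reval diagonal_recf [m] = Some (enc_instance ?I)"
    by (rule reval_diagonal_recf) (simp add: m_def)
  then have "reval h [m] = reval d [enc_instance ?I]"
    unfolding h_def by (intro reval_Comp) simp
  \<comment> \<open>Totality of \<open>d\<close> makes \<open>h\<close> defined on \<open>m\<close>,
    as \<open>g_unblockable_query_iff\<close> demands.\<close>
  then have h: "reval h [m] = Some (if enc_instance ?I \<in> ?A then 1 else 0)"
    by (simp add: d)
  have "enc_instance ?I \<in> ?A \<longleftrightarrow> g_unblockable (query_rule, map_of [(0, Con m)])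
      (set (program h), set (input_facts m)) (hc_of [])"
    using is_kb_program is_head_choice_Nil is_trigger_query
    unfolding mem_Collect_eq inj_eq[OF inj_enc_instance] by blast
  \<comment> \<open>The answer 1 is a nonzero value and blocks the goal, while the answer 0 derives
    it.\<close>
  also have "\<dots> \<longleftrightarrow> enc_instance ?I \<notin> ?A"
    using g_unblockable_query_iff[OF h] by (cases "enc_instance ?I \<in> ?A") (simp_all only: if_True if_False, simp_all)
  finally show False by blast
qed

end
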